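(* Let $\mathcal A,\mathcal B$ be precontextual categories and $\mathcal C$ a contextual category, with underlying categories $A,B,C$. A functor $H:A\times B\to C$ is a bimorphism from $(\mathcal A,\mathcal B)$ to $\mathcal C$ if and only if there exists a contextual functor $F:\mathcal B\to\mathcal C^{\mathcal A}$ such that $H$ is the image under the isomorphism $(C^A)^B\cong C^{A\times B}$ of the composite $$B\xrightarrow{\;F\;}|\mathcal C^{\mathcal A}|\xrightarrow{\;(-)_\heartsuit\;}C^A .$$ This establishes a bijection, natural in $\mathcal A,\mathcal B\in\mathrm{Precont}^{\mathrm{op}}$ and $\mathcal C\in\mathrm{Cont}$, between contextual functors $\mathcal B\to\mathcal C^{\mathcal A}$ and bimorphisms $(\mathcal A,\mathcal B)\to\mathcal C$.
   Context: A precontextual category $\mathcal C$ consists of: a category $|\mathcal C|$ (with a set of objects); a length function $\ell$ from objects to $\mathbb N$; a function $\partial$ from objects to objects with $\ell(\partial a)=\ell(a)-1$ if $\ell(a)\ge 1$ and $\partial a=a$ if $\ell(a)=0$; for each object $a$ with $\ell(a)\ge1$ a morphism $\mathbf p_a:a\to\partial a$; and a set $\mathbf Q$ of commutative squares in $|\mathcal C|$ having left side some $\mathbf p_a$ and right side some $\mathbf p_b$. A display map (written $\twoheadrightarrow$) is a finite, possibly empty, composite of maps $\mathbf p_a$; its length is $\ell(\text{domain})-\ell(\text{codomain})$. A distinguished square is a finite vertical composite of elements of $\mathbf Q$; length-1 distinguished squares are the elements of $\mathbf Q$. $\mathcal C$ is a contextual category if moreover: there is a unique object $1_{\mathcal C}$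 of length $0$, and it is terminal; every element of $\mathbf Q$ is a pullback; $\mathbf Q$ contains the identity square of every $\mathbf p_a$ and is closed under horizontal composition; for every $a$ with $\ell(a)\ge 1$ and $f:b\to\partial a$ there is a unique element of $\mathbf Q$ with right side $\mathbf p_a$ and bottom $f$ (hence any display map has a unique distinguished pullback along any map into its codomain). A morphism (contextual functor) is a functor strictly preserving $\ell,\partial,\mathbf p$ and sending $\mathbf Q$ into $\mathbf Q$. $\mathrm{Precont}$, $\mathrm{Cont}$ are the categories of small precontextual, resp. contextual, categories and contextual functors. Gap maps. In a contextual category, let $S$ be a commutative square with top $f':b'\to b$, bottom $f:a'\to a$, left side $b'\twoheadrightarrow a'$ and right side $p:b\twoheadrightarrow a$ display maps. Let $c$ be the top-left corner of the distinguished square with right side $p$ and bottom $f$. The induced map $b'\to c$ is the gap map of $S$; $S$ is a relative length-1 display map if its gap map is a length-1 display map. Exponential. For $\mathcal A$ precontextual and $\mathcal C$ contextual, $D(\mathcal A,\mathcal C)$ is the full subcategory of the functor category $|\mathcal C|^{|\mathcal A|}$ on functors preserving display maps (not necessarily their lengths) and sending every length-0 object to $1_{\mathcal C}$. An indexed sort is a natural transformation $\pi:G\Rightarrow F$ in $D(\mathcal A,\mathcal C)$ such that: (i) for each $a$ with $\ell(a)\ge1$ the naturality square at $\mathbf p_a$ (top $\pi_a$, bottom $\pi_{\partial a}$, sides $G(\mathbf p_a),F(\mathbf p_a)$) is a relative length-1 display map; (ii) for each square in $\mathbf Q$ of $\mathcal A$ with top $f':a\to b$ and sides $\mathbf p_a,\mathbf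 p_b$, if $G(a)\twoheadrightarrow x$, $G(b)\twoheadrightarrow y$ are the gap maps of the naturality squares at $\mathbf p_a,\mathbf p_b$, then the square with these sides, top $G(f')$ and bottom the induced map $x\to y$ is distinguished. An indexed distinguished square is a commutative square in $D(\mathcal A,\mathcal C)$ with top $\alpha':G'\Rightarrow G$, bottom $\alpha:F'\Rightarrow F$ and sides indexed sorts $\pi':G'\Rightarrow F'$, $\pi:G\Rightarrow F$, such that for each $a$ with $\ell(a)\ge 1$, if $G'(a)\twoheadrightarrow y$ and $G(a)\twoheadrightarrow x$ are the gap maps of the naturality squares of $\pi',\pi$ at $\mathbf p_a$, the square with these sides, top $\alpha'_a$ and bottom the induced map $y\to x$ is distinguished. The exponential $\mathcal C^{\mathcal A}$ is the contextual category whose length-$n$ objects are chains $F_n\to\cdots\to F_1\to F_0$ of indexed sorts in $D(\mathcal A,\mathcal C)$ with $F_0$ constant at $1_{\mathcal C}$; morphisms $(F_i)_{i\le n}\to(G_i)_{i\le m}$ are natural transformations $F_n\Rightarrow G_m$; $\partial$ removes $F_n$, with display map $F_n\to F_{n-1}$; elements of $\mathbf Q$ are the squares whose underlying square of natural transformations is an indexed distinguished square. The functor $(-)_\heartsuit:|\mathcal C^{\mathcal A}|\to|\mathcal C|^{|\mathcal A|}$ sends $(F_i)_{i\le n}$ to $F_n$ and is the identity on natural transformations. Bimorphisms. A bimorphism from $(\mathcal A,\mathcal B)$ to $\mathcal C$ is a functor $H:|\mathcal A|\times|\mathcal B|\to|\mathcal C|$ such that: (i) for each $b$, $H(-,b)\in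 D(\mathcal A,\mathcal C)$, and it is the constant functor at $1_{\mathcal C}$ if $\ell(b)=0$; (ii) for $a,b$ of length $\ge1$ the square with top $H(id_a,\mathbf p_b):H(a,b)\to H(a,\partial b)$, bottom $H(id_{\partial a},\mathbf p_b)$ and vertical sides $H(\mathbf p_a,id)$ is a relative length-1 display map; write $\mathrm{gap}_H(a,b)$ for its gap map; (iii) for $b$ of length $\ge1$ and a square in $\mathbf Q$ of $\mathcal A$ with top $f':a_1\to a_2$, the square with sides $\mathrm{gap}_H(a_1,b)$, $\mathrm{gap}_H(a_2,b)$, top $H(f',id_b)$ and bottom the induced map is distinguished; (iv) for $a$ of length $\ge1$ and a square in $\mathbf Q$ of $\mathcal B$ with top $f':b_1\to b_2$, the square with sides $\mathrm{gap}_H(a,b_1)$, $\mathrm{gap}_H(a,b_2)$, top $H(id_a,f')$ and bottom the induced map is distinguished. *)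

theory Defs
  imports "HOL-Library.FuncSet"
begin

section \<open>Categories, functors, natural transformations\<close>

record ('o, 'm) cat =
  Obj :: "'o set"
  Arr :: "'m set"
  Dom :: "'m \<Rightarrow> 'o"
  Cod :: "'m \<Rightarrow> 'o"
  Idn :: "'o \<Rightarrow> 'm"
  Comp :: "'m \<Rightarrow> 'm \<Rightarrow> 'm"  \<comment> \<open>applicative order: \<open>Comp C g f\<close> is \<open>g\<close> after \<open>f\<close>\<close>

definition Hom :: "('o, 'm, 'z) cat_scheme \<Rightarrow> 'o \<Rightarrow> 'o \<Rightarrow> 'm set" where
  "Hom C a b = {f \<in> Arr C. Dom C f = a \<and> Cod C f = b}"

locale category =
  fixes C :: "('o, 'm, 'z) cat_scheme"
  assumes Dom_in: "f \<in> Arr C \<Longrightarrow> Dom C f \<in> Obj C"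
    and Cod_in: "f \<in> Arr C \<Longrightarrow> Cod C f \<in> Obj C"
    and Idn_in: "a \<in> Obj C \<Longrightarrow> Idn C a \<in> Hom C a a"
    and Comp_in: "\<lbrakk>f \<in> Hom C a b; g \<in> Hom C b c\<rbrakk> \<Longrightarrow> Comp C g f \<in> Hom C a c"
    and Comp_Idn_right: "f \<in> Arr C \<Longrightarrow> Comp C f (Idn C (Dom C f)) = f"
    and Comp_Idn_left: "f \<in> Arr C \<Longrightarrow> Comp C (Idn C (Cod C f)) f = f"
    and Comp_assoc: "\<lbrakk>f \<in> Arr C; g \<in> Arr C; h \<in> Arr C; Cod C f = Dom C g; Cod C g = Dom C h\<rbrakk>
      \<Longrightarrow> Comp C h (Comp C g f) = Comp C (Comp C h g) f"

definition prod_cat ::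
    "('o, 'm, 'z) cat_scheme \<Rightarrow> ('p, 'n, 'y) cat_scheme \<Rightarrow> ('o \<times> 'p, 'm \<times> 'n) cat" where
  "prod_cat A B =
    \<lparr>Obj = Obj A \<times> Obj B,
     Arr = Arr A \<times> Arr B,
     Dom = (\<lambda>(f, g). (Dom A f, Dom B g)),
     Cod = (\<lambda>(f, g). (Cod A f, Cod B g)),
     Idn = (\<lambda>(a, b). (Idn A a, Idn B b)),
     Comp = (\<lambda>(f', g') (f, g). (Comp A f' f, Comp B g' g))\<rparr>"

text \<open>Functors and natural transformations are extensional (\<^const>\<open>undefined\<close> off the carrier of
  the source), so that HOL equality is equality of functors and of natural transformations.\<close>

record ('o, 'm, 'p, 'n) func =
  FO :: "'o \<Rightarrow> 'p"
  FA :: "'m \<Rightarrow> 'n"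

definition is_functor ::
    "('o, 'm, 'z) cat_scheme \<Rightarrow> ('p, 'n, 'y) cat_scheme \<Rightarrow> ('o, 'm, 'p, 'n) func \<Rightarrow> bool" where
  "is_functor A C F \<longleftrightarrow>
     FO F \<in> Obj A \<rightarrow>\<^sub>E Obj C \<and>
     FA F \<in> Arr A \<rightarrow>\<^sub>E Arr C \<and>
     (\<forall>f\<in>Arr A. Dom C (FA F f) = FO F (Dom A f) \<and> Cod C (FA F f) = FO F (Cod A f)) \<and>
     (\<forall>a\<in>Obj A. FA F (Idn A a) = Idn C (FO F a)) \<and>
     (\<forall>f\<in>Arr A. \<forall>g\<in>Arr A. Cod A f = Dom A g \<longrightarrow>
        FA F (Comp A g f) = Comp C (FA F g) (FA F f))"

definition id_functor :: "('o, 'm, 'z) cat_scheme \<Rightarrow> ('o, 'm, 'o, 'm) func" where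
  "id_functor A = \<lparr>FO = (\<lambda>a\<in>Obj A. a), FA = (\<lambda>f\<in>Arr A. f)\<rparr>"

definition comp_functor ::
    "('o, 'm, 'z) cat_scheme \<Rightarrow> ('p, 'n, 'q, 'l) func \<Rightarrow> ('o, 'm, 'p, 'n) func
      \<Rightarrow> ('o, 'm, 'q, 'l) func" where
  "comp_functor A G F = \<lparr>FO = compose (Obj A) (FO G) (FO F), FA = compose (Arr A) (FA G) (FA F)\<rparr>"

definition const_functor ::
    "('o, 'm, 'z) cat_scheme \<Rightarrow> ('p, 'n, 'y) cat_scheme \<Rightarrow> 'p \<Rightarrow> ('o, 'm, 'p, 'n) func" where
  "const_functor A C c = \<lparr>FO = (\<lambda>a\<in>Obj A. c), FA = (\<lambda>f\<in>Arr A. Idn C c)\<rparr>"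

definition prod_functor ::
    "('o, 'm, 'z) cat_scheme \<Rightarrow> ('p, 'n, 'y) cat_scheme \<Rightarrow>
     ('o, 'm, 'o1, 'm1) func \<Rightarrow> ('p, 'n, 'p1, 'n1) func \<Rightarrow>
     ('o \<times> 'p, 'm \<times> 'n, 'o1 \<times> 'p1, 'm1 \<times> 'n1) func" where
  "prod_functor A B U V =
    \<lparr>FO = (\<lambda>(a, b)\<in>Obj A \<times> Obj B. (FO U a, FO V b)),
     FA = (\<lambda>(f, g)\<in>Arr A \<times> Arr B. (FA U f, FA V g))\<rparr>"

record ('o, 'm, 'p, 'n) ntrans =
  ntdom :: "('o, 'm, 'p, 'n) func"
  ntcod :: "('o, 'm, 'p, 'n) func"
  ntmap :: "'o \<Rightarrow> 'n"

definition is_ntrans ::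
    "('o, 'm, 'z) cat_scheme \<Rightarrow> ('p, 'n, 'y) cat_scheme \<Rightarrow> ('o, 'm, 'p, 'n) ntrans \<Rightarrow> bool" where
  "is_ntrans A C \<eta> \<longleftrightarrow>
     is_functor A C (ntdom \<eta>) \<and> is_functor A C (ntcod \<eta>) \<and>
     ntmap \<eta> \<in> extensional (Obj A) \<and>
     (\<forall>a\<in>Obj A. ntmap \<eta> a \<in> Hom C (FO (ntdom \<eta>) a) (FO (ntcod \<eta>) a)) \<and>
     (\<forall>f\<in>Arr A. Comp C (FA (ntcod \<eta>) f) (ntmap \<eta> (Dom A f)) =
                 Comp C (ntmap \<eta> (Cod A f)) (FA (ntdom \<eta>) f))"

definition fun_cat ::
    "('o, 'm, 'z) cat_scheme \<Rightarrow> ('p, 'n, 'y) cat_scheme \<Rightarrow>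
     (('o, 'm, 'p, 'n) func, ('o, 'm, 'p, 'n) ntrans) cat" where
  "fun_cat A C =
    \<lparr>Obj = {F. is_functor A C F},
     Arr = {\<eta>. is_ntrans A C \<eta>},
     Dom = ntdom,
     Cod = ntcod,
     Idn = (\<lambda>F. \<lparr>ntdom = F, ntcod = F, ntmap = (\<lambda>a\<in>Obj A. Idn C (FO F a))\<rparr>),
     Comp = (\<lambda>\<theta> \<eta>. \<lparr>ntdom = ntdom \<eta>, ntcod = ntcod \<theta>,
                       ntmap = (\<lambda>a\<in>Obj A. Comp C (ntmap \<theta> a) (ntmap \<eta> a))\<rparr>)\<rparr>"

text \<open>The isomorphism \<open>(C\<^sup>A)\<^sup>B \<cong> C\<^sup>A\<^sup>\<times>\<^sup>B\<close> on objects.\<close>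

definition uncurry_functor ::
    "('o, 'm, 'z) cat_scheme \<Rightarrow> ('p, 'n, 'y) cat_scheme \<Rightarrow> ('q, 'l, 'x) cat_scheme \<Rightarrow>
     ('p, 'n, ('o, 'm, 'q, 'l) func, ('o, 'm, 'q, 'l) ntrans) func \<Rightarrow>
     ('o \<times> 'p, 'm \<times> 'n, 'q, 'l) func" where
  "uncurry_functor A B C K =
    \<lparr>FO = (\<lambda>(a, b)\<in>Obj A \<times> Obj B. FO (FO K b) a),
     FA = (\<lambda>(f, g)\<in>Arr A \<times> Arr B.
            Comp C (FA (FO K (Cod B g)) f) (ntmap (FA K g) (Dom A f)))\<rparr>"


section \<open>Squares\<close>

datatype 'm square = Square (Top: 'm) (Left: 'm) (Right: 'm) (Bottom: 'm)

definition comm_square :: "('o, 'm, 'z) cat_scheme \<Rightarrow> 'm square \<Rightarrow> bool" where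
  "comm_square C S \<longleftrightarrow>
     Top S \<in> Arr C \<and> Left S \<in> Arr C \<and> Right S \<in> Arr C \<and> Bottom S \<in> Arr C \<and>
     Dom C (Top S) = Dom C (Left S) \<and> Cod C (Top S) = Dom C (Right S) \<and>
     Cod C (Left S) = Dom C (Bottom S) \<and> Cod C (Right S) = Cod C (Bottom S) \<and>
     Comp C (Right S) (Top S) = Comp C (Bottom S) (Left S)"

definition is_pullback :: "('o, 'm, 'z) cat_scheme \<Rightarrow> 'm square \<Rightarrow> bool" where
  "is_pullback C S \<longleftrightarrow>
     comm_square C S \<and>
     (\<forall>u\<in>Arr C. \<forall>v\<in>Arr C.
        Dom C u = Dom C v \<and> Cod C u = Dom C (Right S) \<and> Cod C v = Dom C (Bottom S) \<and>
        Comp C (Right S) u = Comp C (Bottom S) v \<longrightarrow>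
        (\<exists>!h. h \<in> Hom C (Dom C u) (Dom C (Top S)) \<and>
              Comp C (Top S) h = u \<and> Comp C (Left S) h = v))"

definition is_terminal :: "('o, 'm, 'z) cat_scheme \<Rightarrow> 'o \<Rightarrow> bool" where
  "is_terminal C t \<longleftrightarrow> t \<in> Obj C \<and> (\<forall>a\<in>Obj C. \<exists>!f. f \<in> Hom C a t)"


section \<open>Precontextual and contextual categories\<close>

record ('o, 'm) precon = "('o, 'm) cat" +
  len :: "'o \<Rightarrow> nat"
  ft :: "'o \<Rightarrow> 'o"  \<comment> \<open>\<open>\<partial>\<close>\<close>
  proj :: "'o \<Rightarrow> 'm"  \<comment> \<open>\<open>\<^bold>p\<close>, meaningful only on objects of positive length\<close>
  QSq :: "'m square set"

locale precontextual = category C for C :: "('o, 'm, 'z) precon_scheme" +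
  assumes ft_in: "a \<in> Obj C \<Longrightarrow> ft C a \<in> Obj C"
    and len_ft: "\<lbrakk>a \<in> Obj C; len C a \<ge> 1\<rbrakk> \<Longrightarrow> len C (ft C a) = len C a - 1"
    and ft_zero: "\<lbrakk>a \<in> Obj C; len C a = 0\<rbrakk> \<Longrightarrow> ft C a = a"
    and proj_in: "\<lbrakk>a \<in> Obj C; len C a \<ge> 1\<rbrakk> \<Longrightarrow> proj C a \<in> Hom C a (ft C a)"
    and QSq_comm: "S \<in> QSq C \<Longrightarrow> comm_square C S"
    and QSq_Left: "S \<in> QSq C \<Longrightarrow> \<exists>a\<in>Obj C. len C a \<ge> 1 \<and> Left S = proj C a"
    and QSq_Right: "S \<in> QSq C \<Longrightarrow> \<exists>b\<in>Obj C. len C b \<ge> 1 \<and> Right S = proj C b"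

locale contextual = precontextual C for C :: "('o, 'm, 'z) precon_scheme" +
  assumes unique_zero: "\<exists>!a. a \<in> Obj C \<and> len C a = 0"
    and zero_terminal: "\<lbrakk>a \<in> Obj C; len C a = 0\<rbrakk> \<Longrightarrow> is_terminal C a"
    and QSq_pullback: "S \<in> QSq C \<Longrightarrow> is_pullback C S"
    and QSq_identity: "\<lbrakk>a \<in> Obj C; len C a \<ge> 1\<rbrakk> \<Longrightarrow>
      Square (Idn C a) (proj C a) (proj C a) (Idn C (ft C a)) \<in> QSq C"
    and QSq_horizontal: "\<lbrakk>Square f' l m f \<in> QSq C; Square g' m r g \<in> QSq C\<rbrakk> \<Longrightarrow>
      Square (Comp C g' f') l r (Comp C g f) \<in> QSq C"
    and QSq_lift: "\<lbrakk>a \<in> Obj C; len C a \<ge> 1; f \<in> Arr C; Cod C f = ft C a\<rbrakk> \<Longrightarrow>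
      \<exists>!S. S \<in> QSq C \<and> Right S = proj C a \<and> Bottom S = f"

definition one :: "('o, 'm, 'z) precon_scheme \<Rightarrow> 'o" where
  "one C = (THE a. a \<in> Obj C \<and> len C a = 0)"

inductive display :: "('o, 'm, 'z) precon_scheme \<Rightarrow> 'm \<Rightarrow> bool" for C where
  display_id: "a \<in> Obj C \<Longrightarrow> display C (Idn C a)"
| display_proj: "\<lbrakk>a \<in> Obj C; len C a \<ge> 1; display C g; Dom C g = ft C a\<rbrakk> \<Longrightarrow>
    display C (Comp C g (proj C a))"

definition display1 :: "('o, 'm, 'z) precon_scheme \<Rightarrow> 'm \<Rightarrow> bool" where
  "display1 C f \<longleftrightarrow> display C f \<and> int (len C (Dom C f)) - int (len C (Cod C f)) = 1"

text \<open>The empty vertical composite on a map \<open>f\<close> has \<open>f\<close> as top and bottom and identities as sides.\<close>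

inductive distinguished :: "('o, 'm, 'z) precon_scheme \<Rightarrow> 'm square \<Rightarrow> bool" for C where
  distinguished_id: "f \<in> Arr C \<Longrightarrow>
    distinguished C (Square f (Idn C (Dom C f)) (Idn C (Cod C f)) f)"
| distinguished_QSq: "\<lbrakk>distinguished C (Square f' l r f); Square f'' l' r' f' \<in> QSq C\<rbrakk> \<Longrightarrow>
    distinguished C (Square f'' (Comp C l l') (Comp C r r') f)"

definition ctx_functor ::
    "('o, 'm, 'z) precon_scheme \<Rightarrow> ('p, 'n, 'y) precon_scheme \<Rightarrow> ('o, 'm, 'p, 'n) func \<Rightarrow> bool" where
  "ctx_functor A B F \<longleftrightarrow>
     is_functor A B F \<and>
     (\<forall>a\<in>Obj A. len B (FO F a) = len A a \<and> ft B (FO F a) = FO F (ft A a)) \<and>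
     (\<forall>a\<in>Obj A. len A a \<ge> 1 \<longrightarrow> FA F (proj A a) = proj B (FO F a)) \<and>
     (\<forall>S\<in>QSq A. map_square (FA F) S \<in> QSq B)"


section \<open>Gap maps\<close>

definition dist_pb :: "('o, 'm, 'z) precon_scheme \<Rightarrow> 'm \<Rightarrow> 'm \<Rightarrow> 'm square" where
  "dist_pb C p f = (THE T. distinguished C T \<and> Right T = p \<and> Bottom T = f)"

definition gap :: "('o, 'm, 'z) precon_scheme \<Rightarrow> 'm square \<Rightarrow> 'm" where
  "gap C S = (let T = dist_pb C (Right S) (Bottom S) in
     THE h. h \<in> Hom C (Dom C (Top S)) (Dom C (Top T)) \<and>
            Comp C (Top T) h = Top S \<and> Comp C (Left T) h = Left S)"

definition rel_display1 :: "('o, 'm, 'z) precon_scheme \<Rightarrow> 'm square \<Rightarrow> bool" where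
  "rel_display1 C S \<longleftrightarrow>
     comm_square C S \<and> display C (Left S) \<and> display C (Right S) \<and> display1 C (gap C S)"

text \<open>The map between the codomains of the gap maps of \<open>S\<close> and \<open>S'\<close> induced by a map \<open>u\<close> between
  the bottom left corners and a map \<open>v\<close> between the top right corners.\<close>

definition corner_map ::
    "('o, 'm, 'z) precon_scheme \<Rightarrow> 'm square \<Rightarrow> 'm square \<Rightarrow> 'm \<Rightarrow> 'm \<Rightarrow> 'm" where
  "corner_map C S S' u v =
    (let T = dist_pb C (Right S) (Bottom S); T' = dist_pb C (Right S') (Bottom S') in
     THE h. h \<in> Hom C (Dom C (Top T)) (Dom C (Top T')) \<and>
            Comp C (Left T') h = Comp C u (Left T) \<and>
            Comp C (Top T') h = Comp C v (Top T))"

definition gap_square ::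
    "('o, 'm, 'z) precon_scheme \<Rightarrow> 'm square \<Rightarrow> 'm square \<Rightarrow> 'm \<Rightarrow> 'm \<Rightarrow> 'm \<Rightarrow> 'm square" where
  "gap_square C S S' t u v = Square t (gap C S) (gap C S') (corner_map C S S' u v)"


section \<open>The exponential\<close>

definition D_functor ::
    "('o, 'm, 'z) precon_scheme \<Rightarrow> ('p, 'n, 'y) precon_scheme \<Rightarrow> ('o, 'm, 'p, 'n) func \<Rightarrow> bool" where
  "D_functor A C F \<longleftrightarrow>
     is_functor A C F \<and>
     (\<forall>f. display A f \<longrightarrow> display C (FA F f)) \<and>
     (\<forall>a\<in>Obj A. len A a = 0 \<longrightarrow> FO F a = one C)"

definition D_cat ::
    "('o, 'm, 'z) precon_scheme \<Rightarrow> ('p, 'n, 'y) precon_scheme \<Rightarrow>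
     (('o, 'm, 'p, 'n) func, ('o, 'm, 'p, 'n) ntrans) cat" where
  "D_cat A C = (fun_cat A C)
    \<lparr>Obj := {F. D_functor A C F},
     Arr := {\<eta>. is_ntrans A C \<eta> \<and> D_functor A C (ntdom \<eta>) \<and> D_functor A C (ntcod \<eta>)}\<rparr>"

definition nat_square ::
    "('o, 'm, 'z) cat_scheme \<Rightarrow> ('o, 'm, 'p, 'n) ntrans \<Rightarrow> 'm \<Rightarrow> 'n square" where
  "nat_square A \<pi> f =
     Square (ntmap \<pi> (Dom A f)) (FA (ntdom \<pi>) f) (FA (ntcod \<pi>) f) (ntmap \<pi> (Cod A f))"

definition indexed_sort ::
    "('o, 'm, 'z) precon_scheme \<Rightarrow> ('p, 'n, 'y) precon_scheme \<Rightarrow> ('o, 'm, 'p, 'n) ntrans \<Rightarrow> bool" where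
  "indexed_sort A C \<pi> \<longleftrightarrow>
     \<pi> \<in> Arr (D_cat A C) \<and>
     (\<forall>a\<in>Obj A. len A a \<ge> 1 \<longrightarrow> rel_display1 C (nat_square A \<pi> (proj A a))) \<and>
     (\<forall>S\<in>QSq A. distinguished C
        (gap_square C (nat_square A \<pi> (Left S)) (nat_square A \<pi> (Right S))
           (FA (ntdom \<pi>) (Top S)) (FA (ntdom \<pi>) (Bottom S)) (FA (ntcod \<pi>) (Top S))))"

definition indexed_dist_square ::
    "('o, 'm, 'z) precon_scheme \<Rightarrow> ('p, 'n, 'y) precon_scheme \<Rightarrow>
     ('o, 'm, 'p, 'n) ntrans square \<Rightarrow> bool" where
  "indexed_dist_square A C S \<longleftrightarrow>
     comm_square (D_cat A C) S \<and> indexed_sort A C (Left S) \<and> indexed_sort A C (Right S) \<and>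
     (\<forall>a\<in>Obj A. len A a \<ge> 1 \<longrightarrow> distinguished C
        (gap_square C (nat_square A (Left S) (proj A a)) (nat_square A (Right S) (proj A a))
           (ntmap (Top S) a) (ntmap (Top S) (ft A a)) (ntmap (Bottom S) a)))"

text \<open>A chain \<open>F\<^sub>n \<rightarrow> \<dots> \<rightarrow> F\<^sub>1 \<rightarrow> F\<^sub>0\<close> is the list of its \<open>n\<close> indexed sorts, starting with
  \<open>F\<^sub>n \<rightarrow> F\<^sub>n\<^sub>-\<^sub>1\<close>. As \<open>F\<^sub>0\<close> is fixed, it is left implicit.\<close>

type_synonym ('o, 'm, 'p, 'n) chain = "('o, 'm, 'p, 'n) ntrans list"

fun chain_top ::
    "('o, 'm, 'z) precon_scheme \<Rightarrow> ('p, 'n, 'y) precon_scheme \<Rightarrow> ('o, 'm, 'p, 'n) chain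
      \<Rightarrow> ('o, 'm, 'p, 'n) func" where
  "chain_top A C [] = const_functor A C (one C)"
| "chain_top A C (\<pi> # c) = ntdom \<pi>"

fun is_chain ::
    "('o, 'm, 'z) precon_scheme \<Rightarrow> ('p, 'n, 'y) precon_scheme \<Rightarrow> ('o, 'm, 'p, 'n) chain \<Rightarrow> bool" where
  "is_chain A C [] \<longleftrightarrow> True"
| "is_chain A C (\<pi> # c) \<longleftrightarrow> indexed_sort A C \<pi> \<and> ntcod \<pi> = chain_top A C c \<and> is_chain A C c"

text \<open>An arrow \<open>(c, d, \<eta>)\<close> of the exponential records its source and target chains, which the
  natural transformation \<open>\<eta>\<close> alone does not determine.\<close>

type_synonym ('o, 'm, 'p, 'n) exp_arr =
  "('o, 'm, 'p, 'n) chain \<times> ('o, 'm, 'p, 'n) chain \<times> ('o, 'm, 'p, 'n) ntrans"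

definition exp_arrows ::
    "('o, 'm, 'z) precon_scheme \<Rightarrow> ('p, 'n, 'y) precon_scheme \<Rightarrow> ('o, 'm, 'p, 'n) exp_arr set" where
  "exp_arrows A C = {(c, d, \<eta>). is_chain A C c \<and> is_chain A C d \<and>
     \<eta> \<in> Hom (fun_cat A C) (chain_top A C c) (chain_top A C d)}"

definition chain_proj :: "('o, 'm, 'p, 'n) chain \<Rightarrow> ('o, 'm, 'p, 'n) exp_arr" where
  "chain_proj c = (c, tl c, hd c)"

definition exponential ::
    "('o, 'm, 'z) precon_scheme \<Rightarrow> ('p, 'n, 'y) precon_scheme \<Rightarrow>
     (('o, 'm, 'p, 'n) chain, ('o, 'm, 'p, 'n) exp_arr) precon" where
  "exponential A C =
    \<lparr>Obj = {c. is_chain A C c},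
     Arr = exp_arrows A C,
     Dom = (\<lambda>(c, d, \<eta>). c),
     Cod = (\<lambda>(c, d, \<eta>). d),
     Idn = (\<lambda>c. (c, c, Idn (fun_cat A C) (chain_top A C c))),
     Comp = (\<lambda>(c', d', \<eta>') (c, d, \<eta>). (c, d', Comp (fun_cat A C) \<eta>' \<eta>)),
     len = length,
     ft = tl,
     proj = chain_proj,
     QSq = {Square (c, d, \<eta>) (chain_proj c) (chain_proj d) (tl c, tl d, \<theta>) | c d \<eta> \<theta>.
       c \<noteq> [] \<and> d \<noteq> [] \<and>
       (c, d, \<eta>) \<in> exp_arrows A C \<and> (tl c, tl d, \<theta>) \<in> exp_arrows A C \<and>
       indexed_dist_square A C (Square \<eta> (hd c) (hd d) \<theta>)}\<rparr>"

definition heart ::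
    "('o, 'm, 'z) precon_scheme \<Rightarrow> ('p, 'n, 'y) precon_scheme \<Rightarrow>
     (('o, 'm, 'p, 'n) chain, ('o, 'm, 'p, 'n) exp_arr,
      ('o, 'm, 'p, 'n) func, ('o, 'm, 'p, 'n) ntrans) func" where
  "heart A C =
    \<lparr>FO = (\<lambda>c\<in>Obj (exponential A C). chain_top A C c),
     FA = (\<lambda>(c, d, \<eta>)\<in>Arr (exponential A C). \<eta>)\<rparr>"


section \<open>Bimorphisms\<close>

definition fix_snd ::
    "('o, 'm, 'z) cat_scheme \<Rightarrow> ('p, 'n, 'y) cat_scheme \<Rightarrow> ('o \<times> 'p, 'm \<times> 'n, 'q, 'l) func
      \<Rightarrow> 'p \<Rightarrow> ('o, 'm, 'q, 'l) func" where
  "fix_snd A B H b = \<lparr>FO = (\<lambda>a\<in>Obj A. FO H (a, b)), FA = (\<lambda>f\<in>Arr A. FA H (f, Idn B b))\<rparr>"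

definition bi_square ::
    "('o, 'm, 'z) cat_scheme \<Rightarrow> ('p, 'n, 'y) cat_scheme \<Rightarrow> ('o \<times> 'p, 'm \<times> 'n, 'q, 'l) func
      \<Rightarrow> 'm \<Rightarrow> 'n \<Rightarrow> 'l square" where
  "bi_square A B H f g =
     Square (FA H (Idn A (Dom A f), g)) (FA H (f, Idn B (Dom B g)))
            (FA H (f, Idn B (Cod B g))) (FA H (Idn A (Cod A f), g))"

definition bimorphism ::
    "('o, 'm, 'z) precon_scheme \<Rightarrow> ('p, 'n, 'y) precon_scheme \<Rightarrow> ('q, 'l, 'x) precon_scheme
      \<Rightarrow> ('o \<times> 'p, 'm \<times> 'n, 'q, 'l) func \<Rightarrow> bool" where
  "bimorphism A B C H \<longleftrightarrow>
     is_functor (prod_cat A B) C H \<and>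
     (\<forall>b\<in>Obj B. D_functor A C (fix_snd A B H b) \<and>
        (len B b = 0 \<longrightarrow> fix_snd A B H b = const_functor A C (one C))) \<and>
     (\<forall>a\<in>Obj A. \<forall>b\<in>Obj B. len A a \<ge> 1 \<and> len B b \<ge> 1 \<longrightarrow>
        rel_display1 C (bi_square A B H (proj A a) (proj B b))) \<and>
     (\<forall>b\<in>Obj B. \<forall>S\<in>QSq A. len B b \<ge> 1 \<longrightarrow> distinguished C
        (gap_square C
           (bi_square A B H (Left S) (proj B b)) (bi_square A B H (Right S) (proj B b))
           (FA H (Top S, Idn B b)) (FA H (Bottom S, Idn B b)) (FA H (Top S, Idn B (ft B b))))) \<and>
     (\<forall>a\<in>Obj A. \<forall>S\<in>QSq B. len A a \<ge> 1 \<longrightarrow> distinguished C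
        (gap_square C
           (bi_square A B H (proj A a) (Left S)) (bi_square A B H (proj A a) (Right S))
           (FA H (Idn A a, Top S)) (FA H (Idn A (ft A a), Top S)) (FA H (Idn A a, Bottom S))))"

definition bimorphism_of ::
    "('o, 'm, 'z) precon_scheme \<Rightarrow> ('p, 'n, 'y) precon_scheme \<Rightarrow> ('q, 'l, 'x) precon_scheme
      \<Rightarrow> ('p, 'n, ('o, 'm, 'q, 'l) chain, ('o, 'm, 'q, 'l) exp_arr) func
      \<Rightarrow> ('o \<times> 'p, 'm \<times> 'n, 'q, 'l) func" where
  "bimorphism_of A B C F = uncurry_functor A B C (comp_functor B (heart A C) F)"


section \<open>Functoriality in the three arguments\<close>

text \<open>For contextual functors \<open>U : A' \<rightarrow> A\<close> and \<open>W : C \<rightarrow> C'\<close>, the functor \<open>C\<^sup>A \<rightarrow> C'\<^sup>A\<^sup>'\<close> of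
  exponentials is given by \<open>F \<mapsto> W \<circ> F \<circ> U\<close> at every stage of a chain.\<close>

definition whisker_functor ::
    "('o1, 'm1, 'z) cat_scheme \<Rightarrow> ('o1, 'm1, 'o, 'm) func \<Rightarrow> ('p, 'n, 'p1, 'n1) func \<Rightarrow>
     ('o, 'm, 'p, 'n) func \<Rightarrow> ('o1, 'm1, 'p1, 'n1) func" where
  "whisker_functor A' U W F = comp_functor A' W (comp_functor A' F U)"

definition whisker_ntrans ::
    "('o1, 'm1, 'z) cat_scheme \<Rightarrow> ('o1, 'm1, 'o, 'm) func \<Rightarrow> ('p, 'n, 'p1, 'n1) func \<Rightarrow>
     ('o, 'm, 'p, 'n) ntrans \<Rightarrow> ('o1, 'm1, 'p1, 'n1) ntrans" where
  "whisker_ntrans A' U W \<eta> =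
    \<lparr>ntdom = whisker_functor A' U W (ntdom \<eta>),
     ntcod = whisker_functor A' U W (ntcod \<eta>),
     ntmap = (\<lambda>a\<in>Obj A'. FA W (ntmap \<eta> (FO U a)))\<rparr>"

definition exp_map ::
    "('o1, 'm1, 'z) precon_scheme \<Rightarrow> ('o, 'm, 'y) precon_scheme \<Rightarrow> ('p, 'n, 'x) precon_scheme \<Rightarrow>
     ('o1, 'm1, 'o, 'm) func \<Rightarrow> ('p, 'n, 'p1, 'n1) func \<Rightarrow>
     (('o, 'm, 'p, 'n) chain, ('o, 'm, 'p, 'n) exp_arr,
      ('o1, 'm1, 'p1, 'n1) chain, ('o1, 'm1, 'p1, 'n1) exp_arr) func" where
  "exp_map A' A C U W =
    \<lparr>FO = (\<lambda>c\<in>Obj (exponential A C). map (whisker_ntrans A' U W) c),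
     FA = (\<lambda>(c, d, \<eta>)\<in>Arr (exponential A C).
       (map (whisker_ntrans A' U W) c, map (whisker_ntrans A' U W) d, whisker_ntrans A' U W \<eta>))\<rparr>"

text \<open>The actions of \<open>U : A' \<rightarrow> A\<close>, \<open>V : B' \<rightarrow> B\<close>, \<open>W : C \<rightarrow> C'\<close> on contextual functors
  \<open>B \<rightarrow> C\<^sup>A\<close> and on bimorphisms \<open>(A, B) \<rightarrow> C\<close>.\<close>

definition exp_action ::
    "('o1, 'm1, 'z) precon_scheme \<Rightarrow> ('q1, 'k1, 'y) precon_scheme \<Rightarrow>
     ('o, 'm, 'x) precon_scheme \<Rightarrow> ('p, 'n, 'w) precon_scheme \<Rightarrow>
     ('o1, 'm1, 'o, 'm) func \<Rightarrow> ('q1, 'k1, 'q, 'k) func \<Rightarrow> ('p, 'n, 'p1, 'n1) func \<Rightarrow>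
     ('q, 'k, ('o, 'm, 'p, 'n) chain, ('o, 'm, 'p, 'n) exp_arr) func \<Rightarrow>
     ('q1, 'k1, ('o1, 'm1, 'p1, 'n1) chain, ('o1, 'm1, 'p1, 'n1) exp_arr) func" where
  "exp_action A' B' A C U V W F = comp_functor B' (exp_map A' A C U W) (comp_functor B' F V)"

definition bi_action ::
    "('o1, 'm1, 'z) precon_scheme \<Rightarrow> ('q1, 'k1, 'y) precon_scheme \<Rightarrow>
     ('o1, 'm1, 'o, 'm) func \<Rightarrow> ('q1, 'k1, 'q, 'k) func \<Rightarrow> ('p, 'n, 'p1, 'n1) func \<Rightarrow>
     ('o \<times> 'q, 'm \<times> 'k, 'p, 'n) func \<Rightarrow> ('o1 \<times> 'q1, 'm1 \<times> 'k1, 'p1, 'n1) func" where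
  "bi_action A' B' U V W H =
     comp_functor (prod_cat A' B') W (comp_functor (prod_cat A' B') H (prod_functor A' B' U V))"

end

theory Submission
  imports Defs
begin

text \<open>For a functor \<open>H : A \<times> B \<rightarrow> C\<close>, every arrow \<open>g\<close> of \<open>B\<close> yields a natural transformation
  \<open>H(-, g)\<close>. Its naturality squares at the maps \<open>\<^bold>p\<^sub>a\<close> are the squares in the definition of a
  bimorphism, so \<open>H\<close> is a bimorphism iff each \<open>H(-, b)\<close> lies in \<open>D(A, C)\<close> (and is constant for \<open>b\<close>
  of length 0), each \<open>H(-, \<^bold>p\<^sub>b)\<close> is an indexed sort, and \<open>H(-, S)\<close> is an indexed distinguished square
  for each \<open>S\<close> in \<open>\<^bold>Q\<close>. This is exactly what makes \<open>b \<mapsto> (H(-, \<^bold>p\<^sub>b), H(-, \<^bold>p\<^sub>\<partial>\<^sub>b), \<dots>)\<close> a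
  contextual functor into the exponential, and a contextual functor is forced to have this form by
  its compatibility with \<open>\<partial>\<close> and \<open>\<^bold>p\<close>. Naturality in \<open>C\<close> rests on the
  uniqueness of distinguished pullbacks: a contextual functor preserves them, hence also gap maps
  and the maps induced between corners of pullbacks. Bimorphisms are then stable under the action
  because the bijection transports the action on contextual functors.\<close>

section \<open>Functors and natural transformations\<close>

lemma (in category) Idn_props [simp]:
  assumes "a \<in> Obj C"
  shows "Idn C a \<in> Arr C" "Dom C (Idn C a) = a" "Cod C (Idn C a) = a"
  using Idn_in[OF assms] by (auto simp: Hom_def)

lemma (in category) Comp_props:
  assumes "f \<in> Arr C" "g \<in> Arr C" "Cod C f = Dom C g"
  shows "Comp C g f \<in> Arr C" "Dom C (Comp C g f) = Dom C f" "Cod C (Comp C g f) = Cod C g"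
  using Comp_in[of f "Dom C f" "Cod C f" g "Cod C g"] assms by (auto simp: Hom_def)

lemma (in precontextual) proj_props:
  assumes "a \<in> Obj C" "len C a \<ge> 1"
  shows "proj C a \<in> Arr C" "Dom C (proj C a) = a" "Cod C (proj C a) = ft C a"
  using proj_in[OF assms] by (auto simp: Hom_def)

lemma is_functorI:
  assumes "FO F \<in> extensional (Obj A)" "FA F \<in> extensional (Arr A)"
    and "\<And>a. a \<in> Obj A \<Longrightarrow> FO F a \<in> Obj C" "\<And>f. f \<in> Arr A \<Longrightarrow> FA F f \<in> Arr C"
    and "\<And>f. f \<in> Arr A \<Longrightarrow> Dom C (FA F f) = FO F (Dom A f)"
    and "\<And>f. f \<in> Arr A \<Longrightarrow> Cod C (FA F f) = FO F (Cod A f)"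
    and "\<And>a. a \<in> Obj A \<Longrightarrow> FA F (Idn A a) = Idn C (FO F a)"
    and "\<And>f g. \<lbrakk>f \<in> Arr A; g \<in> Arr A; Cod A f = Dom A g\<rbrakk>
      \<Longrightarrow> FA F (Comp A g f) = Comp C (FA F g) (FA F f)"
  shows "is_functor A C F"
  using assms by (auto simp: is_functor_def PiE_iff)

lemma is_functorD:
  assumes "is_functor A C F"
  shows "FO F \<in> extensional (Obj A)" "FA F \<in> extensional (Arr A)"
    and "\<And>a. a \<in> Obj A \<Longrightarrow> FO F a \<in> Obj C" "\<And>f. f \<in> Arr A \<Longrightarrow> FA F f \<in> Arr C"
    and "\<And>f. f \<in> Arr A \<Longrightarrow> Dom C (FA F f) = FO F (Dom A f)"
    and "\<And>f. f \<in> Arr A \<Longrightarrow> Cod C (FA F f) = FO F (Cod A f)"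
    and "\<And>a. a \<in> Obj A \<Longrightarrow> FA F (Idn A a) = Idn C (FO F a)"
    and "\<And>f g. \<lbrakk>f \<in> Arr A; g \<in> Arr A; Cod A f = Dom A g\<rbrakk>
      \<Longrightarrow> FA F (Comp A g f) = Comp C (FA F g) (FA F f)"
  using assms by (auto simp: is_functor_def PiE_iff)

lemma func_eqI:
  assumes "FO F \<in> extensional X" "FO G \<in> extensional X"
    and "FA F \<in> extensional Y" "FA G \<in> extensional Y"
    and "\<And>a. a \<in> X \<Longrightarrow> FO F a = FO G a" "\<And>f. f \<in> Y \<Longrightarrow> FA F f = FA G f"
  shows "F = (G :: ('o, 'm, 'p, 'n) func)"
  using assms by (intro func.equality) (auto intro: extensionalityI)

lemma comp_functor_ext [simp]:
  "FO (comp_functor A G F) \<in> extensional (Obj A)" "FA (comp_functor A G F) \<in> extensional (Arr A)"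
  by (simp_all add: comp_functor_def)

lemma comp_functor_app [simp]:
  "a \<in> Obj A \<Longrightarrow> FO (comp_functor A G F) a = FO G (FO F a)"
  "f \<in> Arr A \<Longrightarrow> FA (comp_functor A G F) f = FA G (FA F f)"
  by (simp_all add: comp_functor_def compose_def)

lemma id_functor_app [simp]:
  "a \<in> Obj A \<Longrightarrow> FO (id_functor A) a = a" "f \<in> Arr A \<Longrightarrow> FA (id_functor A) f = f"
  by (simp_all add: id_functor_def)

lemma (in category) is_functor_comp:
  assumes F: "is_functor C D F" and G: "is_functor D E G"
  shows "is_functor C E (comp_functor C G F)"
  by (rule is_functorI)
    (simp_all add: is_functorD[OF F] is_functorD[OF G] Dom_in Cod_in Comp_props)

lemma (in category) is_functor_const:
  assumes "category D" "d \<in> Obj D"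
  shows "is_functor C D (const_functor C D d)"
proof -
  interpret D: category D by fact
  have "Comp D (Idn D d) (Idn D d) = Idn D d"
    using D.Comp_Idn_right[of "Idn D d"] assms(2) by simp
  then show ?thesis
    using assms(2) by (intro is_functorI) (auto simp: const_functor_def Dom_in Cod_in Comp_props)
qed

lemma is_ntransD:
  assumes "is_ntrans A C \<eta>"
  shows "is_functor A C (ntdom \<eta>)" "is_functor A C (ntcod \<eta>)" "ntmap \<eta> \<in> extensional (Obj A)"
    and "\<And>a. a \<in> Obj A \<Longrightarrow> ntmap \<eta> a \<in> Arr C"
    and "\<And>a. a \<in> Obj A \<Longrightarrow> Dom C (ntmap \<eta> a) = FO (ntdom \<eta>) a"
    and "\<And>a. a \<in> Obj A \<Longrightarrow> Cod C (ntmap \<eta> a) = FO (ntcod \<eta>) a"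
    and "\<And>f. f \<in> Arr A \<Longrightarrow> Comp C (FA (ntcod \<eta>) f) (ntmap \<eta> (Dom A f)) =
      Comp C (ntmap \<eta> (Cod A f)) (FA (ntdom \<eta>) f)"
  using assms by (auto simp: is_ntrans_def Hom_def)

lemma ntrans_eqI:
  assumes "ntdom \<eta> = ntdom \<theta>" "ntcod \<eta> = ntcod \<theta>"
    and "ntmap \<eta> \<in> extensional X" "ntmap \<theta> \<in> extensional X"
    and "\<And>a. a \<in> X \<Longrightarrow> ntmap \<eta> a = ntmap \<theta> a"
  shows "\<eta> = (\<theta> :: ('o, 'm, 'p, 'n) ntrans)"
  using assms by (intro ntrans.equality) (auto intro: extensionalityI)

lemma (in category) nat_square_comm:
  assumes "is_ntrans C D \<eta>" "f \<in> Arr C"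
  shows "comm_square D (nat_square C \<eta> f)"
  using is_ntransD[OF assms(1)] is_functorD[OF is_ntransD(1)[OF assms(1)]]
    is_functorD[OF is_ntransD(2)[OF assms(1)]] assms(2)
  by (simp add: comm_square_def nat_square_def Dom_in Cod_in)

lemma functor_comm_square:
  assumes F: "is_functor C D F" and S: "comm_square C S"
  shows "comm_square D (map_square (FA F) S)"
  using S is_functorD[OF F] by (cases S) (simp add: comm_square_def, metis)

section \<open>Distinguished squares and gap maps\<close>

lemma is_pullbackI:
  assumes "comm_square C S"
    and "\<And>x u v. \<lbrakk>u \<in> Hom C x (Dom C (Right S)); v \<in> Hom C x (Dom C (Bottom S));
        Comp C (Right S) u = Comp C (Bottom S) v\<rbrakk>
      \<Longrightarrow> \<exists>!h. h \<in> Hom C x (Dom C (Top S)) \<and> Comp C (Top S) h = u \<and> Comp C (Left S) h = v"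
  shows "is_pullback C S"
  unfolding is_pullback_def using assms(1) by (intro conjI ballI impI assms(2)) (auto simp: Hom_def)

lemma is_pullbackD:
  assumes "is_pullback C S"
    and "u \<in> Hom C x (Dom C (Right S))" "v \<in> Hom C x (Dom C (Bottom S))"
    and "Comp C (Right S) u = Comp C (Bottom S) v"
  shows "\<exists>!h. h \<in> Hom C x (Dom C (Top S)) \<and> Comp C (Top S) h = u \<and> Comp C (Left S) h = v"
proof -
  have "Dom C u = Dom C v \<and> Cod C u = Dom C (Right S) \<and> Cod C v = Dom C (Bottom S) \<and>
      Comp C (Right S) u = Comp C (Bottom S) v \<longrightarrow>
      (\<exists>!h. h \<in> Hom C (Dom C u) (Dom C (Top S)) \<and> Comp C (Top S) h = u \<and> Comp C (Left S) h = v)"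
    using assms(1-3) unfolding is_pullback_def Hom_def by blast
  then show ?thesis
    using assms by (simp add: Hom_def)
qed

section \<open>Display maps and their unique factorisation\<close>

context precontextual
begin

lemma display_props:
  assumes "display C f"
  shows "f \<in> Arr C" "len C (Cod C f) \<le> len C (Dom C f)"
proof -
  have "f \<in> Arr C \<and> len C (Cod C f) \<le> len C (Dom C f)"
    using assms
  proof induction
    case (display_proj a g)
    then show ?case
      using len_ft[of a] by (simp add: proj_props Comp_props) linarith
  qed simp
  then show "f \<in> Arr C" "len C (Cod C f) \<le> len C (Dom C f)" by simp_all
qed

text \<open>The strict drop of length is what separates a nonempty composite of projections from an
  identity; it settles the mixed cases of \<open>display_eqI\<close> and, through
  \<open>distinguished_QSq_props\<close>, those of \<open>distinguished_eqI\<close>.\<close>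

lemma display_proj_props:
  assumes "a \<in> Obj C" "len C a \<ge> 1" "display C g" "Dom C g = ft C a"
  shows "Dom C (Comp C g (proj C a)) = a" "Cod C (Comp C g (proj C a)) = Cod C g"
    "len C (Cod C g) < len C a"
  using display_props[OF assms(3)] assms len_ft[OF assms(1,2)] Comp_props[of "proj C a" g]
    proj_props[OF assms(1,2)] by auto

text \<open>A display map is the composite of \<open>len (Dom f) - len (Cod f)\<close> projections starting at its
  domain, hence a decomposition of it into projections is unique.\<close>

lemma display_eqI:
  assumes "display C f" "display C g" "Dom C f = Dom C g" "Cod C f = Cod C g"
  shows "f = g"
  using assms
proof (induction arbitrary: g)
  case (display_id a)
  from display_id(2) show ?case
  proof cases
    case (display_proj a' g')
    then show ?thesis
      using display_id display_proj_props[of a' g'] by auto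
  qed (use display_id in simp)
next
  case (display_proj a f)
  note f = display_proj_props[OF display_proj.hyps]
  from \<open>display C g\<close> show ?case
  proof cases
    case (display_id b)
    then have "a = b" "Cod C f = b"
      using f display_proj.prems by auto
    then show ?thesis
      using f(3) by simp
  next
    case (display_proj b g')
    note g = display_proj_props[OF display_proj(2-5)]
    have "a = b" "Cod C f = Cod C g'"
      using f g display_proj.prems \<open>g = _\<close> by auto
    then show ?thesis
      using display_proj.IH[of g'] display_proj.hyps(4) display_proj by auto
  qed
qed

lemma proj_display:
  assumes "a \<in> Obj C" "len C a \<ge> 1"
  shows "display C (proj C a)"
  using display.display_proj[OF assms display_id[OF ft_in[OF assms(1)]]] Comp_Idn_left[of "proj C a"]
    assms by (simp add: proj_props ft_in)

lemma distinguished_props: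
  assumes "distinguished C S"
  shows "comm_square C S" "display C (Right S)"
proof -
  have "comm_square C S \<and> display C (Right S)"
    using assms
  proof induction
    case (distinguished_id f)
    then show ?case
      by (simp add: comm_square_def Dom_in Cod_in Comp_Idn_right Comp_Idn_left display_id)
  next
    case (distinguished_QSq f' l r f f'' l' r')
    have q: "comm_square C (Square f'' l' r' f')" and d: "comm_square C (Square f' l r f)"
      using QSq_comm distinguished_QSq by auto
    have "Comp C (Comp C r r') f'' = Comp C r (Comp C f' l')"
      using q d by (simp add: comm_square_def Comp_assoc[symmetric])
    also have "\<dots> = Comp C f (Comp C l l')"
      using q d by (simp add: comm_square_def Comp_assoc)
    finally have "comm_square C (Square f'' (Comp C l l') (Comp C r r') f)"
      using q d by (simp add: comm_square_def Comp_props)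
    moreover obtain b where b: "b \<in> Obj C" "len C b \<ge> 1" "r' = proj C b"
      using QSq_Right[OF distinguished_QSq(2)] by auto
    then have "display C (Comp C r r')"
      using q d distinguished_QSq by (auto simp: comm_square_def proj_props intro!: display.intros)
    ultimately show ?case by simp
  qed
  then show "comm_square C S" "display C (Right S)" by simp_all
qed

end

section \<open>Distinguished squares as chosen pullbacks\<close>

context contextual
begin

lemma one_unique: "one C \<in> Obj C" "len C (one C) = 0" "\<lbrakk>a \<in> Obj C; len C a = 0\<rbrakk> \<Longrightarrow> one C = a"
  using theI'[OF unique_zero] unique_zero by (auto simp: one_def)

text \<open>Packages the inversion of a nonempty vertical composite: the object \<open>b\<close> is
  recovered as the domain of the whole right side, which lets two decompositions with the same right
  side be compared.\<close>

lemma distinguished_QSq_props: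
  assumes "distinguished C (Square f' l r f)" "Square f'' l' r' f' \<in> QSq C"
  obtains b where "b \<in> Obj C" "len C b \<ge> 1" "r' = proj C b" "display C r" "Dom C r = ft C b"
    "Dom C (Comp C r r') = b" "Cod C r = Cod C f" "Cod C (Comp C r r') = Cod C f" "len C (Cod C f) < len C b"
    "f' \<in> Arr C" "Cod C f' = ft C b"
proof -
  obtain b where b: "b \<in> Obj C" "len C b \<ge> 1" "r' = proj C b"
    using QSq_Right[OF assms(2)] by auto
  have c: "comm_square C (Square f'' l' r' f')" "comm_square C (Square f' l r f)" "display C r"
    using assms QSq_comm distinguished_props by fastforce+
  have e: "Dom C r = ft C b" "Cod C r = Cod C f" "f' \<in> Arr C" "Cod C f' = ft C b"
    using c b(3) proj_props[OF b(1,2)] by (auto simp: comm_square_def)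
  show thesis
    using that[OF b c(3) e(1)] display_proj_props[OF b(1,2) c(3) e(1)] e b(3) by simp
qed

text \<open>The pasting lemma for pullbacks, by induction on the number of squares. A cone is
  factored through the lower square first, and the resulting map is one leg of a cone over the upper
  square.\<close>

lemma distinguished_pullback:
  assumes "distinguished C S"
  shows "is_pullback C S"
  using assms
proof induction
  case (distinguished_id f)
  show ?case
  proof (rule is_pullbackI)
    show "comm_square C (Square f (Idn C (Dom C f)) (Idn C (Cod C f)) f)"
      using distinguished_props distinguished.distinguished_id[OF distinguished_id] by blast
    fix x u v
    assume "u \<in> Hom C x (Dom C (Right (Square f (Idn C (Dom C f)) (Idn C (Cod C f)) f)))"
      and v: "v \<in> Hom C x (Dom C (Bottom (Square f (Idn C (Dom C f)) (Idn C (Cod C f)) f)))"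
      and "Comp C (Right (Square f (Idn C (Dom C f)) (Idn C (Cod C f)) f)) u =
        Comp C (Bottom (Square f (Idn C (Dom C f)) (Idn C (Cod C f)) f)) v"
    then have u: "u = Comp C f v"
      using Comp_Idn_left[of u] distinguished_id by (auto simp: Hom_def Cod_in)
    have id: "Comp C (Idn C (Dom C f)) k = k" if "k \<in> Hom C x (Dom C f)" for k
      using Comp_Idn_left[of k] that by (auto simp: Hom_def)
    show "\<exists>!h. h \<in> Hom C x (Dom C (Top (Square f (Idn C (Dom C f)) (Idn C (Cod C f)) f))) \<and>
        Comp C (Top (Square f (Idn C (Dom C f)) (Idn C (Cod C f)) f)) h = u \<and>
        Comp C (Left (Square f (Idn C (Dom C f)) (Idn C (Cod C f)) f)) h = v"
      unfolding u using v id by (intro ex1I[of _ v]) (simp_all, metis)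
  qed
next
  case (distinguished_QSq f' l r f f'' l' r')
  let ?S = "Square f'' (Comp C l l') (Comp C r r') f"
  have q: "is_pullback C (Square f'' l' r' f')" and d: "is_pullback C (Square f' l r f)"
    using QSq_pullback distinguished_QSq by auto
  have "comm_square C (Square f'' l' r' f')" "comm_square C (Square f' l r f)"
    using q d by (auto simp: is_pullback_def)
  then have c: "f'' \<in> Hom C (Dom C f'') (Dom C r')" "l' \<in> Hom C (Dom C f'') (Dom C f')"
    "r' \<in> Hom C (Dom C r') (Dom C r)" "f' \<in> Hom C (Dom C f') (Dom C r)"
    "l \<in> Hom C (Dom C f') (Dom C f)" "r \<in> Hom C (Dom C r) (Cod C r)"
    "Comp C r' f'' = Comp C f' l'"
    by (auto simp: comm_square_def Hom_def)
  show ?case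
  proof (rule is_pullbackI)
    show "comm_square C ?S"
      using distinguished_props distinguished.distinguished_QSq[OF distinguished_QSq(1,2)] by blast
    fix x u v
    assume "u \<in> Hom C x (Dom C (Right ?S))" "v \<in> Hom C x (Dom C (Bottom ?S))"
      and "Comp C (Right ?S) u = Comp C (Bottom ?S) v"
    then have h: "u \<in> Hom C x (Dom C r')" "v \<in> Hom C x (Dom C f)" "Comp C r (Comp C r' u) = Comp C f v"
      using c Comp_in[OF c(3) c(6)] Comp_assoc[of u r' r] by (auto simp: Hom_def)
    have ru: "Comp C r' u \<in> Hom C x (Dom C r)"
      using Comp_in[OF h(1) c(3)] .
    have "\<exists>!k. k \<in> Hom C x (Dom C f') \<and> Comp C f' k = Comp C r' u \<and> Comp C l k = v"
      using is_pullbackD[OF d, of "Comp C r' u" x v] ru h by simp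
    then obtain k where k: "k \<in> Hom C x (Dom C f')" "Comp C f' k = Comp C r' u" "Comp C l k = v"
      and kU: "\<And>k'. \<lbrakk>k' \<in> Hom C x (Dom C f'); Comp C f' k' = Comp C r' u; Comp C l k' = v\<rbrakk> \<Longrightarrow> k' = k"
      by metis
    have "\<exists>!h. h \<in> Hom C x (Dom C f'') \<and> Comp C f'' h = u \<and> Comp C l' h = k"
      using is_pullbackD[OF q, of u x k] h k by simp
    then obtain w where w: "w \<in> Hom C x (Dom C f'')" "Comp C f'' w = u" "Comp C l' w = k"
      and wU: "\<And>w'. \<lbrakk>w' \<in> Hom C x (Dom C f''); Comp C f'' w' = u; Comp C l' w' = k\<rbrakk> \<Longrightarrow> w' = w"
      by metis
    have ll: "Comp C (Comp C l l') h = Comp C l (Comp C l' h)" if "h \<in> Hom C x (Dom C f'')" for h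
      using Comp_assoc[of h l' l] that c by (simp add: Hom_def)
    show "\<exists>!h. h \<in> Hom C x (Dom C (Top ?S)) \<and> Comp C (Top ?S) h = u \<and> Comp C (Left ?S) h = v"
    proof (rule ex1I[of _ w])
      show "w \<in> Hom C x (Dom C (Top ?S)) \<and> Comp C (Top ?S) w = u \<and> Comp C (Left ?S) w = v"
        using w k ll by simp
      fix w' assume "w' \<in> Hom C x (Dom C (Top ?S)) \<and> Comp C (Top ?S) w' = u \<and> Comp C (Left ?S) w' = v"
      then have w': "w' \<in> Hom C x (Dom C f'')" "Comp C f'' w' = u" "Comp C l (Comp C l' w') = v"
        using ll[of w'] by auto
      \<comment> \<open>Composing a rival \<open>w'\<close> with \<open>l'\<close> gives another
        solution of the lower problem, which must be \<open>k\<close>; only then does uniqueness in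
        the upper square apply.\<close>
      have "Comp C f' (Comp C l' w') = Comp C (Comp C f' l') w'"
        using w' c(2,4) by (intro Comp_assoc) (auto simp: Hom_def)
      also have "\<dots> = Comp C r' (Comp C f'' w')"
        unfolding c(7)[symmetric] using w' c(1,3) by (intro Comp_assoc[symmetric]) (auto simp: Hom_def)
      finally have "Comp C l' w' = k"
        using w' Comp_in[OF w'(1) c(2)] by (intro kU) auto
      then show "w' = w" using w' wU by blast
    qed
  qed
qed

text \<open>The right side determines its factorisation by \<open>display_eqI\<close>, so both
  composites end with a square over the same projection. The induction hypothesis identifies the
  squares below, hence the bottom of the topmost one, and \<open>QSq_lift\<close> allows only one
  such square.\<close>

lemma distinguished_eqI:
  assumes "distinguished C S" "distinguished C T" "Right S = Right T" "Bottom S = Bottom T"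
  shows "S = T"
  using assms
proof (induction arbitrary: T)
  case (distinguished_id f)
  from distinguished_id(2) show ?case
  proof cases
    case (distinguished_QSq f' l r f1 f'' l' r')
    then show ?thesis
      using distinguished_id distinguished_QSq_props[OF distinguished_QSq(2,3)]
      by (metis Cod_in Idn_props(2) less_irrefl square.sel(3,4))
  qed (use distinguished_id in simp)
next
  case (distinguished_QSq f' l r f f'' l' r')
  obtain b where b: "b \<in> Obj C" "len C b \<ge> 1" "r' = proj C b" "display C r" "Dom C r = ft C b"
    "Dom C (Comp C r r') = b" "Cod C r = Cod C f" "Cod C (Comp C r r') = Cod C f" "len C (Cod C f) < len C b"
    "f' \<in> Arr C" "Cod C f' = ft C b"
    using distinguished_QSq_props[OF distinguished_QSq(1,2)] by blast
  from distinguished_QSq(4) show ?case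
  proof cases
    case (distinguished_id g)
    then show ?thesis
      using distinguished_QSq b by (metis Cod_in Idn_props(2) less_irrefl square.sel(3,4))
  next
    case T: (distinguished_QSq g' m s g g'' m' s')
    have e: "Comp C s s' = Comp C r r'" "g = f"
      using T distinguished_QSq.prems by auto
    obtain b' where b': "s' = proj C b'" "display C s" "Dom C s = ft C b'"
      "Dom C (Comp C s s') = b'" "Cod C s = Cod C g"
      using distinguished_QSq_props[OF T(2,3)] by blast
    then have "b' = b" "s = r"
      using e b display_eqI[of s r] by auto
    then have "Square f' l r f = Square g' m s g"
      using distinguished_QSq.IH[OF T(2)] e by simp
    then have eq: "f' = g'" "l = m" "r = s" by auto
    let ?P = "\<lambda>S. S \<in> QSq C \<and> Right S = proj C b \<and> Bottom S = f'"
    have "\<exists>!S. ?P S"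
      using b by (intro QSq_lift)
    moreover have "?P (Square f'' l' r' f')"
      using distinguished_QSq.hyps(2) b(3) by simp
    moreover have "?P (Square g'' m' s' g')"
      using T(3) b'(1) \<open>b' = b\<close> eq(1) by simp
    ultimately have "Square f'' l' r' f' = Square g'' m' s' g'"
      by blast
    then show ?thesis
      unfolding T(1) using eq(2,3) e(2) by simp
  qed
qed

text \<open>The projections in \<open>p\<close> are pulled back from the codomain upwards: the top
  of the square obtained so far becomes the bottom over which the next projection is lifted.\<close>

lemma distinguished_exists:
  assumes "display C p" "f \<in> Arr C" "Cod C f = Cod C p"
  shows "\<exists>S. distinguished C S \<and> Right S = p \<and> Bottom S = f"
  using assms
proof (induction)
  case (display_id a)
  then have "distinguished C (Square f (Idn C (Dom C f)) (Idn C a) f)"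
    using distinguished_id[of f C] by simp
  then show ?case by (metis square.sel(3,4))
next
  case (display_proj a g)
  then have "Cod C f = Cod C g"
    using display_proj_props[of a g] by simp
  then obtain S where S: "distinguished C S" "Right S = g" "Bottom S = f"
    using display_proj by blast
  then have "Top S \<in> Arr C" "Cod C (Top S) = ft C a"
    using distinguished_props(1)[OF S(1)] display_proj.hyps by (auto simp: comm_square_def)
  then obtain Q where Q: "Q \<in> QSq C" "Right Q = proj C a" "Bottom Q = Top S"
    using QSq_lift display_proj.hyps by metis
  have "distinguished C (Square (Top Q) (Comp C (Left S) (Left Q)) (Comp C g (proj C a)) f)"
    using distinguished_QSq[of C "Top S" "Left S" "Right S" "Bottom S" "Top Q" "Left Q" "Right Q"] S Q
    by (metis square.collapse)
  then show ?case by (metis square.sel(3,4))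
qed

lemma dist_pb_eqI:
  assumes "distinguished C T" "Right T = p" "Bottom T = f"
  shows "dist_pb C p f = T"
  unfolding dist_pb_def using assms distinguished_eqI by blast

lemma dist_pb_props:
  assumes "display C p" "f \<in> Arr C" "Cod C f = Cod C p"
  shows "distinguished C (dist_pb C p f)" "Right (dist_pb C p f) = p" "Bottom (dist_pb C p f) = f"
  using distinguished_exists[OF assms] dist_pb_eqI by metis+

lemma pullback_ex1:
  assumes "display C p" "f \<in> Arr C" "Cod C f = Cod C p"
    and "u \<in> Hom C x (Dom C p)" "v \<in> Hom C x (Dom C f)" "Comp C p u = Comp C f v"
  shows "\<exists>!h. h \<in> Hom C x (Dom C (Top (dist_pb C p f))) \<and>
    Comp C (Top (dist_pb C p f)) h = u \<and> Comp C (Left (dist_pb C p f)) h = v"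
  using is_pullbackD[OF distinguished_pullback[OF dist_pb_props(1)[OF assms(1-3)]]] assms(4-6)
    dist_pb_props(2,3)[OF assms(1-3)] by metis

lemma gap_ex1:
  assumes "comm_square C S" "display C (Right S)"
  defines "T \<equiv> dist_pb C (Right S) (Bottom S)"
  shows "\<exists>!h. h \<in> Hom C (Dom C (Top S)) (Dom C (Top T)) \<and> Comp C (Top T) h = Top S \<and> Comp C (Left T) h = Left S"
  unfolding T_def using assms(1,2) by (intro pullback_ex1) (auto simp: comm_square_def Hom_def)

end

text \<open>The existence of \<open>w\<close> completes \<open>u\<close> and \<open>v\<close> to a map of cospans, so that the description
  in \<^const>\<open>corner_map\<close> is satisfiable.\<close>

definition corner_compatible ::
    "('o, 'm, 'z) precon_scheme \<Rightarrow> 'm square \<Rightarrow> 'm square \<Rightarrow> 'm \<Rightarrow> 'm \<Rightarrow> bool" where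
  "corner_compatible C S S' u v \<longleftrightarrow>
     comm_square C S \<and> comm_square C S' \<and> display C (Right S) \<and> display C (Right S') \<and>
     u \<in> Hom C (Dom C (Bottom S)) (Dom C (Bottom S')) \<and>
     v \<in> Hom C (Dom C (Right S)) (Dom C (Right S')) \<and>
     (\<exists>w\<in>Hom C (Cod C (Right S)) (Cod C (Right S')).
        Comp C (Right S') v = Comp C w (Right S) \<and> Comp C w (Bottom S) = Comp C (Bottom S') u)"

section \<open>Maps induced between the corners of two pullbacks\<close>

context contextual
begin

lemma dist_pb_corner:
  assumes "comm_square C S" "display C (Right S)"
  defines "T \<equiv> dist_pb C (Right S) (Bottom S)"
  shows "distinguished C T" "comm_square C T" "Right T = Right S" "Bottom T = Bottom S"
    "Top T \<in> Hom C (Dom C (Top T)) (Dom C (Right S))"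
    "Left T \<in> Hom C (Dom C (Top T)) (Dom C (Bottom S))"
proof -
  have "Bottom S \<in> Arr C" "Cod C (Bottom S) = Cod C (Right S)"
    using assms(1) by (auto simp: comm_square_def)
  from dist_pb_props[OF assms(2) this]
  show T: "distinguished C T" "Right T = Right S" "Bottom T = Bottom S"
    by (simp_all add: T_def)
  show "comm_square C T"
    using distinguished_props(1)[OF T(1)] .
  then show "Top T \<in> Hom C (Dom C (Top T)) (Dom C (Right S))"
    "Left T \<in> Hom C (Dom C (Top T)) (Dom C (Bottom S))"
    using T(2,3) by (auto simp: comm_square_def Hom_def)
qed

text \<open>The third map \<open>w\<close> makes the two transported legs a cone over the second
  cospan: both ways around equal \<open>w\<close> after the diagonal of the first pullback
  square.\<close>

lemma corner_ex1:
  assumes "corner_compatible C S S' u v"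
  defines "T \<equiv> dist_pb C (Right S) (Bottom S)" and "T' \<equiv> dist_pb C (Right S') (Bottom S')"
  shows "\<exists>!h. h \<in> Hom C (Dom C (Top T)) (Dom C (Top T')) \<and>
    Comp C (Left T') h = Comp C u (Left T) \<and> Comp C (Top T') h = Comp C v (Top T)"
proof -
  obtain w where w: "w \<in> Hom C (Cod C (Right S)) (Cod C (Right S'))"
      "Comp C (Right S') v = Comp C w (Right S)" "Comp C w (Bottom S) = Comp C (Bottom S') u"
    and S: "comm_square C S" "display C (Right S)" and S': "comm_square C S'" "display C (Right S')"
    and u: "u \<in> Hom C (Dom C (Bottom S)) (Dom C (Bottom S'))"
    and v: "v \<in> Hom C (Dom C (Right S)) (Dom C (Right S'))"
    using assms(1) by (auto simp: corner_compatible_def)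
  note T = dist_pb_corner[OF S, folded T_def]
  have t: "Top T \<in> Hom C (Dom C (Top T)) (Dom C (Right S))"
      "Left T \<in> Hom C (Dom C (Top T)) (Dom C (Bottom S))"
      "Comp C (Right S) (Top T) = Comp C (Bottom S) (Left T)"
    using T by (simp_all add: comm_square_def)
  have s: "Right S \<in> Hom C (Dom C (Right S)) (Cod C (Right S))"
    "Bottom S \<in> Hom C (Dom C (Bottom S)) (Cod C (Right S))"
    "Right S' \<in> Hom C (Dom C (Right S')) (Cod C (Right S'))"
    "Bottom S' \<in> Hom C (Dom C (Bottom S')) (Cod C (Right S'))"
    using S S' by (auto simp: comm_square_def Hom_def)
  have assoc: "Comp C h (Comp C g f) = Comp C (Comp C h g) f"
    if "f \<in> Hom C a b" "g \<in> Hom C b c" "h \<in> Hom C c d" for f g h a b c d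
    using that Comp_assoc by (auto simp: Hom_def)
  have "Comp C (Right S') (Comp C v (Top T)) = Comp C w (Comp C (Right S) (Top T))"
    using assoc[OF t(1) v s(3)] assoc[OF t(1) s(1) w(1)] w(2) by simp
  also have "\<dots> = Comp C (Bottom S') (Comp C u (Left T))"
    using assoc[OF t(2) u s(4)] assoc[OF t(2) s(2) w(1)] w(3) t(3) by simp
  finally have "\<exists>!h. h \<in> Hom C (Dom C (Top T)) (Dom C (Top T')) \<and>
      Comp C (Top T') h = Comp C v (Top T) \<and> Comp C (Left T') h = Comp C u (Left T)"
    unfolding T'_def using S' s Comp_in[OF t(1) v] Comp_in[OF t(2) u]
    by (intro pullback_ex1) (auto simp: Hom_def)
  then show ?thesis by metis
qed

end

section \<open>Contextual functors\<close>

lemma ctx_functorD: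
  assumes "ctx_functor A B F"
  shows "is_functor A B F"
    and "\<And>a. a \<in> Obj A \<Longrightarrow> len B (FO F a) = len A a"
    and "\<And>a. a \<in> Obj A \<Longrightarrow> ft B (FO F a) = FO F (ft A a)"
    and "\<And>a. \<lbrakk>a \<in> Obj A; len A a \<ge> 1\<rbrakk> \<Longrightarrow> FA F (proj A a) = proj B (FO F a)"
    and "\<And>S. S \<in> QSq A \<Longrightarrow> map_square (FA F) S \<in> QSq B"
  using assms by (auto simp: ctx_functor_def)

lemma (in precontextual) ctx_functor_display:
  assumes F: "ctx_functor C D F" and D: "precontextual D" and f: "display C f"
  shows "display D (FA F f)"
  using f
proof induction
  case (display_id a)
  then show ?case
    using is_functorD[OF ctx_functorD(1)[OF F]] by (simp add: display.display_id)
next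
  case (display_proj a g)
  note W = is_functorD[OF ctx_functorD(1)[OF F]] ctx_functorD(2-)[OF F]
  have "g \<in> Arr C" using display_proj display_props by blast
  then have "FA F (Comp C g (proj C a)) = Comp D (FA F g) (proj D (FO F a))"
    using display_proj.hyps by (simp add: W proj_props)
  moreover have "display D (Comp D (FA F g) (proj D (FO F a)))"
    using display_proj \<open>g \<in> Arr C\<close> by (intro display.display_proj) (simp_all add: W)
  ultimately show ?case by simp
qed

text \<open>Preservation of \<open>QSq\<close> extends to vertical composites by functoriality, and
  to the empty composite because identities are preserved.\<close>

lemma (in precontextual) ctx_functor_distinguished:
  assumes F: "ctx_functor C D F" and D: "precontextual D" and S: "distinguished C S"
  shows "distinguished D (map_square (FA F) S)"
  using S
proof induction
  case (distinguished_id f)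
  note W = is_functorD[OF ctx_functorD(1)[OF F]]
  show ?case
    using distinguished.distinguished_id[of "FA F f" D] distinguished_id
    by (simp add: W Dom_in Cod_in)
next
  case (distinguished_QSq f' l r f f'' l' r')
  note W = is_functorD[OF ctx_functorD(1)[OF F]]
  have c: "comm_square C (Square f'' l' r' f')" "comm_square C (Square f' l r f)"
    using distinguished_QSq QSq_comm distinguished_props by blast+
  have "distinguished D (Square (FA F f'') (Comp D (FA F l) (FA F l')) (Comp D (FA F r) (FA F r')) (FA F f))"
    using distinguished_QSq.IH ctx_functorD(5)[OF F distinguished_QSq(2)]
    by (auto intro: distinguished.distinguished_QSq)
  then show ?case
    using c by (simp add: comm_square_def W)
qed

lemma (in precontextual) ctx_functor_comp:
  assumes F: "ctx_functor C D F" and G: "ctx_functor D E G"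
  shows "ctx_functor C E (comp_functor C G F)"
proof -
  note F' = ctx_functorD[OF F] is_functorD[OF ctx_functorD(1)[OF F]]
  note G' = ctx_functorD[OF G]
  have "map_square (FA (comp_functor C G F)) S = map_square (FA G) (map_square (FA F) S)" if "S \<in> QSq C" for S
    using QSq_comm[OF that] by (cases S) (simp add: comm_square_def)
  then show ?thesis
    using F' G' is_functor_comp[OF F'(1) G'(1)]
    by (simp add: ctx_functor_def ft_in proj_props)
qed

locale contextual_functor = S: contextual C + T: contextual C'
  for C :: "('o, 'm, 'z) precon_scheme" and C' :: "('p, 'n, 'y) precon_scheme"
    and W :: "('o, 'm, 'p, 'n) func" +
  assumes ctx_W: "ctx_functor C C' W"
begin

lemmas fun_W = is_functorD[OF ctx_functorD(1)[OF ctx_W]]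

lemma Hom_W: "f \<in> Hom C a b \<Longrightarrow> FA W f \<in> Hom C' (FO W a) (FO W b)"
  by (auto simp: Hom_def fun_W)

lemma Comp_W: "\<lbrakk>f \<in> Hom C a b; g \<in> Hom C b c\<rbrakk> \<Longrightarrow> FA W (Comp C g f) = Comp C' (FA W g) (FA W f)"
  by (auto simp: Hom_def fun_W)

lemma one_W: "FO W (one C) = one C'"
  using S.one_unique(1,2) ctx_functorD(2)[OF ctx_W, of "one C"] fun_W(3)[of "one C"]
  by (metis T.one_unique(3))

lemma display_W: "display C f \<Longrightarrow> display C' (FA W f)"
  by (rule S.ctx_functor_display[OF ctx_W T.precontextual_axioms])

lemma distinguished_W: "distinguished C S \<Longrightarrow> distinguished C' (map_square (FA W) S)"
  by (rule S.ctx_functor_distinguished[OF ctx_W T.precontextual_axioms])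

lemma comm_square_W: "comm_square C S \<Longrightarrow> comm_square C' (map_square (FA W) S)"
  by (rule functor_comm_square[OF ctx_functorD(1)[OF ctx_W]])

text \<open>The image of the chosen square is distinguished with the required right side and bottom,
  and \<open>T.dist_pb_eqI\<close> leaves no other candidate. This strict equality is what all later
  transport along \<open>W\<close> rests on.\<close>

lemma dist_pb_W:
  assumes "comm_square C S" "display C (Right S)"
  shows "dist_pb C' (FA W (Right S)) (FA W (Bottom S)) = map_square (FA W) (dist_pb C (Right S) (Bottom S))"
  using assms S.dist_pb_props[of "Right S" "Bottom S"] distinguished_W
  by (intro T.dist_pb_eqI) (auto simp: square.map_sel comm_square_def)

text \<open>The image of the gap map satisfies the equations that describe the gap map of the image
  square, since the chosen pullbacks correspond by \<open>dist_pb_W\<close>. The last two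
  conclusions supply the typing for the comparison of lengths in
  \<open>rel_display1_W\<close>.\<close>

lemma gap_W:
  assumes S: "comm_square C S" "display C (Right S)"
  shows "gap C' (map_square (FA W) S) = FA W (gap C S)" and "gap C S \<in> Arr C"
    and "Dom C (gap C S) = Dom C (Top S)"
proof -
  let ?T = "dist_pb C (Right S) (Bottom S)"
  have g: "gap C S \<in> Hom C (Dom C (Top S)) (Dom C (Top ?T)) \<and>
      Comp C (Top ?T) (gap C S) = Top S \<and> Comp C (Left ?T) (gap C S) = Left S"
    unfolding gap_def Let_def by (rule theI'[OF S.gap_ex1[OF S]])
  then show "gap C S \<in> Arr C" "Dom C (gap C S) = Dom C (Top S)"
    by (auto simp: Hom_def)
  let ?S' = "map_square (FA W) S"
  let ?T' = "dist_pb C' (Right ?S') (Bottom ?S')"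
  have T': "?T' = map_square (FA W) ?T"
    using dist_pb_W[OF S] by (simp add: square.map_sel)
  note tt = S.dist_pb_corner(5,6)[OF S]
  have gg: "gap C S \<in> Hom C (Dom C (Top S)) (Dom C (Top ?T))" using g by simp
  have "Comp C' (FA W (Top ?T)) (FA W (gap C S)) = FA W (Top S)"
    "Comp C' (FA W (Left ?T)) (FA W (gap C S)) = FA W (Left S)"
    using g Comp_W[OF gg tt(1)] Comp_W[OF gg tt(2)] by simp_all
  moreover have "FA W (gap C S) \<in> Hom C' (Dom C' (FA W (Top S))) (Dom C' (FA W (Top ?T)))"
    using Hom_W[OF gg] tt S by (simp add: Hom_def fun_W comm_square_def)
  ultimately have "FA W (gap C S) \<in> Hom C' (Dom C' (Top ?S')) (Dom C' (Top ?T')) \<and>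
      Comp C' (Top ?T') (FA W (gap C S)) = Top ?S' \<and> Comp C' (Left ?T') (FA W (gap C S)) = Left ?S'"
    unfolding T' by (simp add: square.map_sel)
  then show "gap C' ?S' = FA W (gap C S)"
    using T.gap_ex1[OF comm_square_W[OF S(1)]] S display_W
    unfolding gap_def Let_def by (intro the1_equality) (auto simp: square.map_sel)
qed

lemma rel_display1_W:
  assumes "rel_display1 C S"
  shows "rel_display1 C' (map_square (FA W) S)"
proof -
  have S: "comm_square C S" "display C (Right S)" and g: "display C (gap C S)"
    using assms by (auto simp: rel_display1_def display1_def)
  then have "Dom C (gap C S) \<in> Obj C" "Cod C (gap C S) \<in> Obj C"
    using S.Dom_in S.Cod_in S.display_props by blast+
  then show ?thesis
    using assms comm_square_W display_W gap_W[OF S] ctx_functorD(2)[OF ctx_W]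
    by (auto simp: rel_display1_def display1_def square.map_sel fun_W)
qed

lemma corner_compatible_W:
  assumes "corner_compatible C S S' u v"
  shows "corner_compatible C' (map_square (FA W) S) (map_square (FA W) S') (FA W u) (FA W v)"
proof -
  obtain w where w: "w \<in> Hom C (Cod C (Right S)) (Cod C (Right S'))"
      "Comp C (Right S') v = Comp C w (Right S)" "Comp C w (Bottom S) = Comp C (Bottom S') u"
    and S: "comm_square C S" "display C (Right S)" and S': "comm_square C S'" "display C (Right S')"
    and u: "u \<in> Hom C (Dom C (Bottom S)) (Dom C (Bottom S'))"
    and v: "v \<in> Hom C (Dom C (Right S)) (Dom C (Right S'))"
    using assms(1) by (auto simp: corner_compatible_def)
  have s: "Right S \<in> Hom C (Dom C (Right S)) (Cod C (Right S))"
    "Bottom S \<in> Hom C (Dom C (Bottom S)) (Cod C (Right S))"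
    "Right S' \<in> Hom C (Dom C (Right S')) (Cod C (Right S'))"
    "Bottom S' \<in> Hom C (Dom C (Bottom S')) (Cod C (Right S'))"
    using S S' by (auto simp: comm_square_def Hom_def)
  have "Comp C' (FA W (Right S')) (FA W v) = Comp C' (FA W w) (FA W (Right S))"
    using Comp_W[OF v s(3)] Comp_W[OF s(1) w(1)] w(2) by simp
  moreover have "Comp C' (FA W w) (FA W (Bottom S)) = Comp C' (FA W (Bottom S')) (FA W u)"
    using Comp_W[OF s(2) w(1)] Comp_W[OF u s(4)] w(3) by simp
  ultimately show ?thesis
    using comm_square_W[OF S(1)] comm_square_W[OF S'(1)] display_W[OF S(2)] display_W[OF S'(2)]
      Hom_W[OF u] Hom_W[OF v] Hom_W[OF w(1)] s
    by (auto simp: corner_compatible_def square.map_sel fun_W Hom_def)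
qed

text \<open>As for gap maps, the image of the corner map solves the problem posed in
  \<open>C'\<close>, and \<open>corner_compatible_W\<close> guarantees that this problem has a
  single solution. In this form the conditions on gap squares become instances of
  \<open>distinguished_W\<close>.\<close>

lemma gap_square_W:
  assumes cc: "corner_compatible C S S' u v"
  shows "gap_square C' (map_square (FA W) S) (map_square (FA W) S') (FA W t) (FA W u) (FA W v) =
    map_square (FA W) (gap_square C S S' t u v)"
proof -
  have S: "comm_square C S" "display C (Right S)" and S': "comm_square C S'" "display C (Right S')"
    and u: "u \<in> Hom C (Dom C (Bottom S)) (Dom C (Bottom S'))"
    and v: "v \<in> Hom C (Dom C (Right S)) (Dom C (Right S'))"
    using cc by (auto simp: corner_compatible_def)
  let ?T = "dist_pb C (Right S) (Bottom S)" and ?T' = "dist_pb C (Right S') (Bottom S')"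
  note tt = S.dist_pb_corner(5,6)[OF S] S.dist_pb_corner(5,6)[OF S']
  let ?U = "dist_pb C' (Right (map_square (FA W) S)) (Bottom (map_square (FA W) S))"
  let ?U' = "dist_pb C' (Right (map_square (FA W) S')) (Bottom (map_square (FA W) S'))"
  have U: "?U = map_square (FA W) ?T" "?U' = map_square (FA W) ?T'"
    using dist_pb_W[OF S] dist_pb_W[OF S'] by (simp_all add: square.map_sel)
  let ?h = "corner_map C S S' u v"
  have h: "?h \<in> Hom C (Dom C (Top ?T)) (Dom C (Top ?T')) \<and>
      Comp C (Left ?T') ?h = Comp C u (Left ?T) \<and> Comp C (Top ?T') ?h = Comp C v (Top ?T)"
    unfolding corner_map_def Let_def by (rule theI'[OF S.corner_ex1[OF cc]])
  then have hh: "?h \<in> Hom C (Dom C (Top ?T)) (Dom C (Top ?T'))" by simp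
  have "Comp C' (FA W (Left ?T')) (FA W ?h) = Comp C' (FA W u) (FA W (Left ?T))"
    using h Comp_W[OF hh tt(4)] Comp_W[OF tt(2) u] by simp
  moreover have "Comp C' (FA W (Top ?T')) (FA W ?h) = Comp C' (FA W v) (FA W (Top ?T))"
    using h Comp_W[OF hh tt(3)] Comp_W[OF tt(1) v] by simp
  moreover have "FA W ?h \<in> Hom C' (Dom C' (FA W (Top ?T))) (Dom C' (FA W (Top ?T')))"
    using Hom_W[OF hh] tt by (simp add: Hom_def fun_W)
  ultimately have "FA W ?h \<in> Hom C' (Dom C' (Top ?U)) (Dom C' (Top ?U')) \<and>
      Comp C' (Left ?U') (FA W ?h) = Comp C' (FA W u) (Left ?U) \<and>
      Comp C' (Top ?U') (FA W ?h) = Comp C' (FA W v) (Top ?U)"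
    unfolding U by (simp add: square.map_sel)
  then have "corner_map C' (map_square (FA W) S) (map_square (FA W) S') (FA W u) (FA W v) = FA W ?h"
    unfolding corner_map_def Let_def
    by (intro the1_equality T.corner_ex1 corner_compatible_W cc)
  then show ?thesis
    using gap_W(1)[OF S] gap_W(1)[OF S'] by (simp add: gap_square_def)
qed

end

section \<open>Indexed sorts and whiskering\<close>

lemma Arr_D_cat: "\<eta> \<in> Arr (D_cat A C) \<longleftrightarrow>
    is_ntrans A C \<eta> \<and> D_functor A C (ntdom \<eta>) \<and> D_functor A C (ntcod \<eta>)"
  by (simp add: D_cat_def fun_cat_def)

text \<open>Composites in \<open>D_cat\<close> are records with components restricted to
  \<open>Obj A\<close>; their equality splits into matching endpoints and one equation per
  object.\<close>

lemma comm_square_D_cat: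
  "comm_square (D_cat A C) S \<longleftrightarrow>
     Top S \<in> Arr (D_cat A C) \<and> Left S \<in> Arr (D_cat A C) \<and>
     Right S \<in> Arr (D_cat A C) \<and> Bottom S \<in> Arr (D_cat A C) \<and>
     ntdom (Top S) = ntdom (Left S) \<and> ntcod (Top S) = ntdom (Right S) \<and>
     ntcod (Left S) = ntdom (Bottom S) \<and> ntcod (Right S) = ntcod (Bottom S) \<and>
     (\<forall>a\<in>Obj A. Comp C (ntmap (Right S) a) (ntmap (Top S) a) =
       Comp C (ntmap (Bottom S) a) (ntmap (Left S) a))"
  by (auto simp: comm_square_def D_cat_def fun_cat_def restrict_def fun_eq_iff)

lemma Hom_fun_cat: "\<eta> \<in> Hom (fun_cat A C) F G \<longleftrightarrow> is_ntrans A C \<eta> \<and> ntdom \<eta> = F \<and> ntcod \<eta> = G"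
  by (simp add: Hom_def fun_cat_def)

lemma D_functor_display: "\<lbrakk>D_functor A C F; display A f\<rbrakk> \<Longrightarrow> display C (FA F f)"
  by (simp add: D_functor_def)

context precontextual
begin

text \<open>Guarantees that the corner map in the definition of \<open>indexed_sort\<close> is
  determined by its description.\<close>

lemma indexed_sort_compatible:
  assumes \<pi>: "indexed_sort C D \<pi>" and S: "S \<in> QSq C"
  shows "corner_compatible D (nat_square C \<pi> (Left S)) (nat_square C \<pi> (Right S))
    (FA (ntdom \<pi>) (Bottom S)) (FA (ntcod \<pi>) (Top S))"
proof -
  have n: "is_ntrans C D \<pi>" "D_functor C D (ntcod \<pi>)"
    using \<pi> by (auto simp: indexed_sort_def Arr_D_cat)
  note G = is_functorD[OF is_ntransD(1)[OF n(1)]] and F = is_functorD[OF is_ntransD(2)[OF n(1)]]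
  have c: "comm_square C S" using QSq_comm[OF S] .
  obtain a b where "a \<in> Obj C" "len C a \<ge> 1" "Left S = proj C a" "b \<in> Obj C" "len C b \<ge> 1" "Right S = proj C b"
    using QSq_Left[OF S] QSq_Right[OF S] by blast
  then have "display C (Left S)" "display C (Right S)"
    by (simp_all add: proj_display)
  then have d: "display D (FA (ntcod \<pi>) (Left S))" "display D (FA (ntcod \<pi>) (Right S))"
    using D_functor_display[OF n(2)] by blast+
  \<comment> \<open>The third leg of the map of cospans is the target functor at the bottom of
    \<open>S\<close>: \<open>w1\<close> is that functor applied to \<open>S\<close>, and
    \<open>w2\<close> is naturality of \<open>\<pi>\<close> at the bottom of
    \<open>S\<close>.\<close>
  have w1: "Comp D (FA (ntcod \<pi>) (Right S)) (FA (ntcod \<pi>) (Top S)) =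
      Comp D (FA (ntcod \<pi>) (Bottom S)) (FA (ntcod \<pi>) (Left S))"
    using c F(8)[of "Top S" "Right S"] F(8)[of "Left S" "Bottom S"] by (simp add: comm_square_def)
  have w2: "Comp D (FA (ntcod \<pi>) (Bottom S)) (ntmap \<pi> (Cod C (Left S))) =
      Comp D (ntmap \<pi> (Cod C (Right S))) (FA (ntdom \<pi>) (Bottom S))"
    using c is_ntransD(7)[OF n(1), of "Bottom S"] by (simp add: comm_square_def)
  have arr: "Left S \<in> Arr C" "Right S \<in> Arr C" "Bottom S \<in> Arr C" "Top S \<in> Arr C"
    "Dom C (Bottom S) = Cod C (Left S)" "Cod C (Bottom S) = Cod C (Right S)"
    "Dom C (Top S) = Dom C (Left S)" "Cod C (Top S) = Dom C (Right S)"
    using c by (auto simp: comm_square_def)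
  show ?thesis
    unfolding corner_compatible_def
    using nat_square_comm[OF n(1) arr(1)] nat_square_comm[OF n(1) arr(2)] d w1 w2 arr
    by (intro conjI bexI[of _ "FA (ntcod \<pi>) (Bottom S)"])
      (simp_all add: nat_square_def Hom_def G F is_ntransD(5)[OF n(1)] Cod_in)
qed

text \<open>The third leg is now the component of the bottom side at \<open>ft C a\<close>. One
  equation is naturality of the bottom side at the projection of \<open>a\<close>, the other is
  commutativity of \<open>S\<close> at \<open>ft C a\<close>.\<close>

lemma indexed_dist_square_compatible:
  assumes S: "indexed_dist_square C D S" and a: "a \<in> Obj C" "len C a \<ge> 1"
  shows "corner_compatible D (nat_square C (Left S) (proj C a)) (nat_square C (Right S) (proj C a))
    (ntmap (Top S) (ft C a)) (ntmap (Bottom S) a)"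
proof -
  have c: "comm_square (D_cat C D) S"
    using S by (auto simp: indexed_dist_square_def)
  then have n: "is_ntrans C D (Top S)" "is_ntrans C D (Left S)" "is_ntrans C D (Right S)" "is_ntrans C D (Bottom S)"
    and D: "D_functor C D (ntcod (Left S))" "D_functor C D (ntcod (Right S))"
    by (auto simp: comm_square_D_cat Arr_D_cat)
  note p = proj_props[OF a] and fa = ft_in[OF a(1)]
  note F = is_functorD[OF is_ntransD(2)[OF n(2)]] and F' = is_functorD[OF is_ntransD(2)[OF n(3)]]
  have d: "display D (FA (ntcod (Left S)) (proj C a))" "display D (FA (ntcod (Right S)) (proj C a))"
    using D_functor_display[OF D(1)] D_functor_display[OF D(2)] proj_display[OF a] by simp_all
  have e: "ntdom (Bottom S) = ntcod (Left S)" "ntcod (Bottom S) = ntcod (Right S)"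
    "ntdom (Top S) = ntdom (Left S)" "ntcod (Top S) = ntdom (Right S)"
    using c by (simp_all add: comm_square_D_cat)
  have w1: "Comp D (FA (ntcod (Right S)) (proj C a)) (ntmap (Bottom S) a) =
      Comp D (ntmap (Bottom S) (ft C a)) (FA (ntcod (Left S)) (proj C a))"
    using is_ntransD(7)[OF n(4), of "proj C a"] p e by simp
  have w2: "Comp D (ntmap (Bottom S) (ft C a)) (ntmap (Left S) (ft C a)) =
      Comp D (ntmap (Right S) (ft C a)) (ntmap (Top S) (ft C a))"
    using c fa by (simp add: comm_square_D_cat)
  show ?thesis
    unfolding corner_compatible_def
    using nat_square_comm[OF n(2) p(1)] nat_square_comm[OF n(3) p(1)] d w1 w2 p a fa e
    by (intro conjI bexI[of _ "ntmap (Bottom S) (ft C a)"])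
      (simp_all add: nat_square_def Hom_def F F' is_ntransD(4-6)[OF n(1)] is_ntransD(5)[OF n(2)]
        is_ntransD(5)[OF n(3)] is_ntransD(4-6)[OF n(4)])
qed

end

section \<open>Whiskering of functors, indexed sorts and chains\<close>

lemma whisker_functor_simps [simp]:
  "FO (whisker_functor A' U W F) \<in> extensional (Obj A')"
  "FA (whisker_functor A' U W F) \<in> extensional (Arr A')"
  "a \<in> Obj A' \<Longrightarrow> FO (whisker_functor A' U W F) a = FO W (FO F (FO U a))"
  "f \<in> Arr A' \<Longrightarrow> FA (whisker_functor A' U W F) f = FA W (FA F (FA U f))"
  by (simp_all add: whisker_functor_def)

lemma whisker_ntrans_simps [simp]:
  "ntdom (whisker_ntrans A' U W \<eta>) = whisker_functor A' U W (ntdom \<eta>)"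
  "ntcod (whisker_ntrans A' U W \<eta>) = whisker_functor A' U W (ntcod \<eta>)"
  "ntmap (whisker_ntrans A' U W \<eta>) \<in> extensional (Obj A')"
  "a \<in> Obj A' \<Longrightarrow> ntmap (whisker_ntrans A' U W \<eta>) a = FA W (ntmap \<eta> (FO U a))"
  by (simp_all add: whisker_ntrans_def)

locale whiskering = contextual_functor C C' W + A: precontextual A + A': precontextual A'
  for C :: "('o, 'm, 'z) precon_scheme" and C' :: "('p, 'n, 'y) precon_scheme"
    and W :: "('o, 'm, 'p, 'n) func"
    and A :: "('oa, 'ma, 'za) precon_scheme" and A' :: "('oa1, 'ma1, 'za1) precon_scheme" +
  fixes U :: "('oa1, 'ma1, 'oa, 'ma) func"
  assumes ctx_U: "ctx_functor A' A U"
begin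

abbreviation "whF \<equiv> whisker_functor A' U W"
abbreviation "whN \<equiv> whisker_ntrans A' U W"

lemmas fun_U = is_functorD[OF ctx_functorD(1)[OF ctx_U]]

lemma whisker_is_functor: "is_functor A C F \<Longrightarrow> is_functor A' C' (whF F)"
  unfolding whisker_functor_def
  by (rule A'.is_functor_comp[OF A'.is_functor_comp[OF ctx_functorD(1)[OF ctx_U]] ctx_functorD(1)[OF ctx_W]])

lemma whisker_D_functor:
  assumes "D_functor A C F"
  shows "D_functor A' C' (whF F)"
proof -
  have "display C' (FA (whF F) f)" if "display A' f" for f
    using A'.ctx_functor_display[OF ctx_U A.precontextual_axioms that] A'.display_props(1)[OF that]
      D_functor_display[OF assms] display_W by simp
  moreover have "FO (whF F) a = one C'" if "a \<in> Obj A'" "len A' a = 0" for a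
    using that assms ctx_functorD(2)[OF ctx_U that(1)] by (simp add: D_functor_def fun_U one_W)
  ultimately show ?thesis
    using assms whisker_is_functor by (simp add: D_functor_def)
qed

lemma whisker_is_ntrans:
  assumes "is_ntrans A C \<eta>"
  shows "is_ntrans A' C' (whN \<eta>)"
proof -
  note n = is_ntransD[OF assms] and F = is_functorD[OF is_ntransD(1)[OF assms]]
    and G = is_functorD[OF is_ntransD(2)[OF assms]]
  have "Comp C' (FA W (FA (ntcod \<eta>) (FA U f))) (FA W (ntmap \<eta> (FO U (Dom A' f)))) =
      Comp C' (FA W (ntmap \<eta> (FO U (Cod A' f)))) (FA W (FA (ntdom \<eta>) (FA U f)))" if f: "f \<in> Arr A'" for f
  proof -
    have U: "FA U f \<in> Arr A" "FO U (Dom A' f) = Dom A (FA U f)" "FO U (Cod A' f) = Cod A (FA U f)"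
      "Dom A (FA U f) \<in> Obj A" "Cod A (FA U f) \<in> Obj A"
      using f by (simp_all add: fun_U A'.Dom_in A'.Cod_in)
    have h: "ntmap \<eta> (Dom A (FA U f)) \<in> Hom C (FO (ntdom \<eta>) (Dom A (FA U f))) (FO (ntcod \<eta>) (Dom A (FA U f)))"
      "ntmap \<eta> (Cod A (FA U f)) \<in> Hom C (FO (ntdom \<eta>) (Cod A (FA U f))) (FO (ntcod \<eta>) (Cod A (FA U f)))"
      "FA (ntdom \<eta>) (FA U f) \<in> Hom C (FO (ntdom \<eta>) (Dom A (FA U f))) (FO (ntdom \<eta>) (Cod A (FA U f)))"
      "FA (ntcod \<eta>) (FA U f) \<in> Hom C (FO (ntcod \<eta>) (Dom A (FA U f))) (FO (ntcod \<eta>) (Cod A (FA U f)))"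
      using U(1,4,5) n(4-6) F(4-6) G(4-6) by (simp_all add: Hom_def)
    show ?thesis
      using arg_cong[OF n(7)[OF U(1)], of "FA W"] Comp_W[OF h(1) h(4)] Comp_W[OF h(3) h(2)] U(2,3) by simp
  qed
  then show ?thesis
    using n whisker_is_functor[OF n(1)] whisker_is_functor[OF n(2)]
    by (simp add: is_ntrans_def fun_U fun_W A'.Dom_in A'.Cod_in Hom_def)
qed

text \<open>The bridge from conditions on a whiskered transformation to conditions on the original
  one at \<open>FA U f\<close>, to which the lemmas on images under \<open>W\<close> apply.\<close>

lemma whisker_nat_square:
  "f \<in> Arr A' \<Longrightarrow> nat_square A' (whN \<eta>) f = map_square (FA W) (nat_square A \<eta> (FA U f))"
  by (simp add: nat_square_def fun_U A'.Dom_in A'.Cod_in)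

lemma whisker_Arr_D_cat: "\<eta> \<in> Arr (D_cat A C) \<Longrightarrow> whN \<eta> \<in> Arr (D_cat A' C')"
  by (simp add: Arr_D_cat whisker_is_ntrans whisker_D_functor)

lemma U_proj:
  assumes "a \<in> Obj A'" "len A' a \<ge> 1"
  shows "FO U a \<in> Obj A" "len A (FO U a) \<ge> 1" "FA U (proj A' a) = proj A (FO U a)"
    "FO U (ft A' a) = ft A (FO U a)"
  using assms ctx_functorD[OF ctx_U] by (simp_all add: fun_U)

text \<open>\<open>U\<close> carries the projections and the elements of \<open>QSq\<close> of
  \<open>A'\<close> to those of \<open>A\<close>, where \<open>\<pi>\<close> satisfies the
  conditions; \<open>W\<close> then carries the resulting gap squares to \<open>C'\<close>.\<close>

lemma whisker_indexed_sort:
  assumes "indexed_sort A C \<pi>"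
  shows "indexed_sort A' C' (whN \<pi>)"
  unfolding indexed_sort_def
proof (intro conjI ballI impI)
  show "whN \<pi> \<in> Arr (D_cat A' C')"
    using assms by (simp add: indexed_sort_def whisker_Arr_D_cat)
  fix a assume a: "a \<in> Obj A'" "len A' a \<ge> 1"
  then show "rel_display1 C' (nat_square A' (whN \<pi>) (proj A' a))"
    using assms rel_display1_W U_proj[OF a] by (simp add: whisker_nat_square A'.proj_props indexed_sort_def)
next
  fix S assume S: "S \<in> QSq A'"
  let ?S = "map_square (FA U) S"
  have US: "?S \<in> QSq A"
    using ctx_functorD(5)[OF ctx_U S] .
  have arr: "Top S \<in> Arr A'" "Left S \<in> Arr A'" "Right S \<in> Arr A'" "Bottom S \<in> Arr A'"
    using A'.QSq_comm[OF S] by (auto simp: comm_square_def)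
  have "distinguished C' (map_square (FA W) (gap_square C (nat_square A \<pi> (Left ?S)) (nat_square A \<pi> (Right ?S))
      (FA (ntdom \<pi>) (Top ?S)) (FA (ntdom \<pi>) (Bottom ?S)) (FA (ntcod \<pi>) (Top ?S))))"
    using US assms distinguished_W by (simp add: indexed_sort_def)
  then show "distinguished C' (gap_square C' (nat_square A' (whN \<pi>) (Left S)) (nat_square A' (whN \<pi>) (Right S))
       (FA (ntdom (whN \<pi>)) (Top S)) (FA (ntdom (whN \<pi>)) (Bottom S)) (FA (ntcod (whN \<pi>)) (Top S)))"
    using gap_square_W[OF A.indexed_sort_compatible[OF assms US]] arr
    by (simp add: whisker_nat_square square.map_sel)
qed

lemma whisker_indexed_dist_square:
  assumes S: "indexed_dist_square A C S"
  shows "indexed_dist_square A' C' (map_square whN S)"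
proof -
  have c: "comm_square (D_cat A C) S"
    using S by (auto simp: indexed_dist_square_def)
  have n: "is_ntrans A C (Top S)" "is_ntrans A C (Left S)" "is_ntrans A C (Right S)" "is_ntrans A C (Bottom S)"
    using c by (auto simp: comm_square_D_cat Arr_D_cat)
  have "Comp C' (FA W (ntmap (Right S) (FO U a))) (FA W (ntmap (Top S) (FO U a))) =
      Comp C' (FA W (ntmap (Bottom S) (FO U a))) (FA W (ntmap (Left S) (FO U a)))" if "a \<in> Obj A'" for a
    using c that fun_W(8)[of "ntmap (Top S) (FO U a)" "ntmap (Right S) (FO U a)"]
      fun_W(8)[of "ntmap (Left S) (FO U a)" "ntmap (Bottom S) (FO U a)"]
    by (simp add: comm_square_D_cat fun_U is_ntransD(4-6)[OF n(1)] is_ntransD(4-6)[OF n(2)]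
        is_ntransD(4-6)[OF n(3)] is_ntransD(4-6)[OF n(4)])
  then have "comm_square (D_cat A' C') (map_square whN S)"
    using c by (simp add: comm_square_D_cat whisker_Arr_D_cat square.map_sel)
  moreover have "distinguished C' (gap_square C' (nat_square A' (whN (Left S)) (proj A' a))
      (nat_square A' (whN (Right S)) (proj A' a))
      (ntmap (whN (Top S)) a) (ntmap (whN (Top S)) (ft A' a)) (ntmap (whN (Bottom S)) a))"
    if a: "a \<in> Obj A'" "len A' a \<ge> 1" for a
  proof -
    have "distinguished C (gap_square C (nat_square A (Left S) (proj A (FO U a))) (nat_square A (Right S) (proj A (FO U a)))
       (ntmap (Top S) (FO U a)) (ntmap (Top S) (ft A (FO U a))) (ntmap (Bottom S) (FO U a)))"
      using S U_proj[OF a] by (simp add: indexed_dist_square_def)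
    from distinguished_W[OF this] show ?thesis
      using gap_square_W[OF A.indexed_dist_square_compatible[OF S U_proj(1,2)[OF a]]] U_proj[OF a] a
      by (simp add: whisker_nat_square A'.proj_props A'.ft_in)
  qed
  ultimately show ?thesis
    using S whisker_indexed_sort by (simp add: indexed_dist_square_def square.map_sel)
qed

text \<open>Only the empty chain needs an argument: its implicit top is constant at the object of
  length 0, which \<open>one_W\<close> sends to the corresponding object of
  \<open>C'\<close>.\<close>

lemma whisker_chain_top: "chain_top A' C' (map whN c) = whF (chain_top A C c)"
proof (cases c)
  case Nil
  then show ?thesis
    using S.one_unique(1)
    by (auto simp: const_functor_def fun_U fun_W one_W intro!: func_eqI[of _ "Obj A'" _ "Arr A'"])
qed simp

lemma whisker_is_chain: "is_chain A C c \<Longrightarrow> is_chain A' C' (map whN c)"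
  by (induction c) (auto simp: whisker_indexed_sort whisker_chain_top)

lemma whisker_exp_arrows:
  "(c, d, \<eta>) \<in> exp_arrows A C \<Longrightarrow> (map whN c, map whN d, whN \<eta>) \<in> exp_arrows A' C'"
  by (simp add: exp_arrows_def whisker_is_chain Hom_fun_cat whisker_is_ntrans whisker_chain_top)

end

section \<open>The action on exponentials\<close>

lemma exponential_simps [simp]:
  "Obj (exponential A C) = {c. is_chain A C c}"
  "Arr (exponential A C) = exp_arrows A C"
  "Dom (exponential A C) (c, d, \<eta>) = c"
  "Cod (exponential A C) (c, d, \<eta>) = d"
  "Idn (exponential A C) c = (c, c, Idn (fun_cat A C) (chain_top A C c))"
  "Comp (exponential A C) (c', d', \<theta>) (c, d, \<eta>) = (c, d', Comp (fun_cat A C) \<theta> \<eta>)"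
  "len (exponential A C) c = length c"
  "ft (exponential A C) c = tl c"
  "proj (exponential A C) c = chain_proj c"
  by (simp_all add: exponential_def)

lemma QSq_exponential:
  "S \<in> QSq (exponential A C) \<longleftrightarrow> (\<exists>c d \<eta> \<theta>. S = Square (c, d, \<eta>) (chain_proj c) (chain_proj d) (tl c, tl d, \<theta>) \<and>
     c \<noteq> [] \<and> d \<noteq> [] \<and> (c, d, \<eta>) \<in> exp_arrows A C \<and> (tl c, tl d, \<theta>) \<in> exp_arrows A C \<and>
     indexed_dist_square A C (Square \<eta> (hd c) (hd d) \<theta>))"
  by (auto simp: exponential_def)

lemma exp_arrows_iff:
  "(c, d, \<eta>) \<in> exp_arrows A C \<longleftrightarrow> is_chain A C c \<and> is_chain A C d \<and>
     is_ntrans A C \<eta> \<and> ntdom \<eta> = chain_top A C c \<and> ntcod \<eta> = chain_top A C d"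
  by (simp add: exp_arrows_def Hom_fun_cat)

lemma is_chain_tl: "is_chain A C c \<Longrightarrow> is_chain A C (tl c)"
  by (cases c) auto

lemma chain_proj_arrow: "\<lbrakk>is_chain A C c; c \<noteq> []\<rbrakk> \<Longrightarrow> chain_proj c \<in> exp_arrows A C"
  by (cases c) (auto simp: chain_proj_def exp_arrows_iff indexed_sort_def Arr_D_cat)

lemma Comp_fun_cat_is_ntrans:
  assumes "category A" "category C" "is_ntrans A C \<eta>" "is_ntrans A C \<theta>" "ntcod \<eta> = ntdom \<theta>"
  shows "is_ntrans A C (Comp (fun_cat A C) \<theta> \<eta>)"
proof -
  interpret A: category A by fact
  interpret C: category C by fact
  note n = is_ntransD[OF assms(3)] and m = is_ntransD[OF assms(4)]
  have "Comp C (FA (ntcod \<theta>) f) (Comp C (ntmap \<theta> (Dom A f)) (ntmap \<eta> (Dom A f))) =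
      Comp C (Comp C (ntmap \<theta> (Cod A f)) (ntmap \<eta> (Cod A f))) (FA (ntdom \<eta>) f)" if f: "f \<in> Arr A" for f
  proof -
    note ob = A.Dom_in[OF f] A.Cod_in[OF f]
    note e = n(4-6)[OF ob(1)] n(4-6)[OF ob(2)] m(4-6)[OF ob(1)] m(4-6)[OF ob(2)]
      is_functorD(4-6)[OF n(1) f] is_functorD(4-6)[OF n(2) f] is_functorD(4-6)[OF m(2) f] assms(5)
    have "Comp C (FA (ntcod \<theta>) f) (Comp C (ntmap \<theta> (Dom A f)) (ntmap \<eta> (Dom A f))) =
        Comp C (Comp C (FA (ntcod \<theta>) f) (ntmap \<theta> (Dom A f))) (ntmap \<eta> (Dom A f))"
      using e by (intro C.Comp_assoc) simp_all
    also have "\<dots> = Comp C (ntmap \<theta> (Cod A f)) (Comp C (FA (ntcod \<eta>) f) (ntmap \<eta> (Dom A f)))"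
      unfolding m(7)[OF f] assms(5)[symmetric] using e by (intro C.Comp_assoc[symmetric]) simp_all
    also have "\<dots> = Comp C (Comp C (ntmap \<theta> (Cod A f)) (ntmap \<eta> (Cod A f))) (FA (ntdom \<eta>) f)"
      unfolding n(7)[OF f] using e by (intro C.Comp_assoc) simp_all
    finally show ?thesis .
  qed
  then show ?thesis
    using n m assms(5)
    by (simp add: is_ntrans_def fun_cat_def Hom_def C.Comp_props A.Dom_in A.Cod_in)
qed

lemma Idn_fun_cat_is_ntrans:
  assumes "category A" "category C" "is_functor A C F"
  shows "is_ntrans A C (Idn (fun_cat A C) F)"
proof -
  interpret A: category A by fact
  interpret C: category C by fact
  note F = is_functorD[OF assms(3)]
  have "Comp C (FA F f) (Idn C (FO F (Dom A f))) = Comp C (Idn C (FO F (Cod A f))) (FA F f)" if "f \<in> Arr A" for f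
    using F(4-6)[OF that] C.Comp_Idn_right[of "FA F f"] C.Comp_Idn_left[of "FA F f"] by simp
  then show ?thesis
    using assms F(3) by (simp add: is_ntrans_def fun_cat_def Hom_def A.Dom_in A.Cod_in)
qed

text \<open>Every display map goes to the identity of \<open>one C\<close>, an empty composite of
  projections. This bottom stage of all chains is why functors in \<open>D\<close> may change the
  length of display maps.\<close>

lemma D_functor_const:
  assumes "precontextual A" "contextual C"
  shows "D_functor A C (const_functor A C (one C))"
proof -
  interpret A: precontextual A by fact
  interpret C: contextual C by fact
  show ?thesis
    using A.is_functor_const[OF C.category_axioms C.one_unique(1)] C.one_unique(1) A.display_props(1)
    by (auto simp: D_functor_def const_functor_def intro: display.intros)
qed

lemma chain_top_D_functor:
  assumes "precontextual A" "contextual C" "is_chain A C c"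
  shows "D_functor A C (chain_top A C c)"
  using assms D_functor_const[OF assms(1,2)] by (cases c) (auto simp: indexed_sort_def Arr_D_cat)

lemma chain_top_functor:
  assumes "precontextual A" "contextual C" "is_chain A C c"
  shows "is_functor A C (chain_top A C c)"
  using chain_top_D_functor[OF assms] by (simp add: D_functor_def)

context whiskering
begin

lemma whisker_Idn:
  assumes "is_functor A C F"
  shows "whN (Idn (fun_cat A C) F) = Idn (fun_cat A' C') (whF F)"
  using is_functorD(3)[OF assms]
  by (intro ntrans_eqI[of _ _ "Obj A'"]) (simp_all add: fun_cat_def fun_U fun_W)

lemma whisker_Comp:
  assumes "is_ntrans A C \<eta>" "is_ntrans A C \<theta>" "ntcod \<eta> = ntdom \<theta>"
  shows "whN (Comp (fun_cat A C) \<theta> \<eta>) = Comp (fun_cat A' C') (whN \<theta>) (whN \<eta>)"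
  using is_ntransD(4-6)[OF assms(1)] is_ntransD(4-6)[OF assms(2)] assms(3)
  by (intro ntrans_eqI[of _ _ "Obj A'"]) (simp_all add: fun_cat_def fun_U fun_W)

lemma exp_map_simps [simp]:
  "is_chain A C c \<Longrightarrow> FO (exp_map A' A C U W) c = map whN c"
  "(c, d, \<eta>) \<in> exp_arrows A C \<Longrightarrow> FA (exp_map A' A C U W) (c, d, \<eta>) = (map whN c, map whN d, whN \<eta>)"
  by (simp_all add: exp_map_def)

lemma exp_map_chain_proj:
  assumes "is_chain A C c" "c \<noteq> []"
  shows "FA (exp_map A' A C U W) (chain_proj c) = chain_proj (map whN c)"
  using chain_proj_arrow[OF assms] assms(2) by (simp add: chain_proj_def hd_map map_tl)

text \<open>Whiskering acts on a chain by \<open>map\<close>, which commutes with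
  \<open>length\<close>, with \<open>tl\<close> and, on nonempty lists, with \<open>hd\<close>;
  hence lengths, \<open>ft\<close> and projections are preserved strictly.\<close>

lemma exp_map_ctx_functor: "ctx_functor (exponential A C) (exponential A' C') (exp_map A' A C U W)"
proof -
  note pA = A.precontextual_axioms and cC = S.contextual_axioms
  have "is_functor (exponential A C) (exponential A' C') (exp_map A' A C U W)"
  proof (rule is_functorI)
    show "FO (exp_map A' A C U W) \<in> extensional (Obj (exponential A C))"
      "FA (exp_map A' A C U W) \<in> extensional (Arr (exponential A C))"
      by (simp_all add: exp_map_def)
    fix c assume c: "c \<in> Obj (exponential A C)"
    then show "FO (exp_map A' A C U W) c \<in> Obj (exponential A' C')"
      by (simp add: whisker_is_chain)
    have "is_functor A C (chain_top A C c)"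
      using c chain_top_functor[OF pA cC] by simp
    then have "(c, c, Idn (fun_cat A C) (chain_top A C c)) \<in> exp_arrows A C"
      using c Idn_fun_cat_is_ntrans[OF A.category_axioms S.category_axioms]
      by (simp add: exp_arrows_iff) (simp add: fun_cat_def)
    then show "FA (exp_map A' A C U W) (Idn (exponential A C) c) =
        Idn (exponential A' C') (FO (exp_map A' A C U W) c)"
      using c whisker_Idn[OF \<open>is_functor A C (chain_top A C c)\<close>] by (simp add: whisker_chain_top)
  next
    fix f assume "f \<in> Arr (exponential A C)"
    moreover obtain c d \<eta> where "f = (c, d, \<eta>)" by (cases f)
    ultimately have f: "f = (c, d, \<eta>)" "(c, d, \<eta>) \<in> exp_arrows A C" "is_chain A C c" "is_chain A C d"
      by (auto simp: exp_arrows_iff)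
    show "FA (exp_map A' A C U W) f \<in> Arr (exponential A' C')"
      "Dom (exponential A' C') (FA (exp_map A' A C U W) f) = FO (exp_map A' A C U W) (Dom (exponential A C) f)"
      "Cod (exponential A' C') (FA (exp_map A' A C U W) f) = FO (exp_map A' A C U W) (Cod (exponential A C) f)"
      using f whisker_exp_arrows[OF f(2)] by simp_all
    fix g assume "g \<in> Arr (exponential A C)" and "Cod (exponential A C) f = Dom (exponential A C) g"
    moreover obtain c' d' \<theta> where "g = (c', d', \<theta>)" by (cases g)
    ultimately have g: "g = (d, d', \<theta>)" "(d, d', \<theta>) \<in> exp_arrows A C"
      using f by auto
    have n: "is_ntrans A C \<eta>" "is_ntrans A C \<theta>" "ntcod \<eta> = ntdom \<theta>"
      using f(2) g(2) by (auto simp: exp_arrows_iff)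
    have "(c, d', Comp (fun_cat A C) \<theta> \<eta>) \<in> exp_arrows A C"
      using f(2) g(2) Comp_fun_cat_is_ntrans[OF A.category_axioms S.category_axioms n]
      by (simp add: exp_arrows_iff) (simp add: fun_cat_def)
    then show "FA (exp_map A' A C U W) (Comp (exponential A C) g f) =
        Comp (exponential A' C') (FA (exp_map A' A C U W) g) (FA (exp_map A' A C U W) f)"
      using f g whisker_Comp[OF n] by simp
  qed
  moreover have "map_square (FA (exp_map A' A C U W)) S \<in> QSq (exponential A' C')" if S: "S \<in> QSq (exponential A C)" for S
  proof -
    obtain c d \<eta> \<theta> where S: "S = Square (c, d, \<eta>) (chain_proj c) (chain_proj d) (tl c, tl d, \<theta>)"
      and nz: "c \<noteq> []" "d \<noteq> []" and arr: "(c, d, \<eta>) \<in> exp_arrows A C" "(tl c, tl d, \<theta>) \<in> exp_arrows A C"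
      and ids: "indexed_dist_square A C (Square \<eta> (hd c) (hd d) \<theta>)"
      using S by (auto simp: QSq_exponential)
    have "is_chain A C c" "is_chain A C d"
      using arr by (auto simp: exp_arrows_iff)
    then show ?thesis
      using S nz arr exp_map_chain_proj whisker_exp_arrows[OF arr(1)] whisker_exp_arrows[OF arr(2)]
        whisker_indexed_dist_square[OF ids]
      by (simp add: QSq_exponential map_tl hd_map)
  qed
  ultimately show ?thesis
    by (auto simp: ctx_functor_def map_tl is_chain_tl exp_map_chain_proj Suc_le_eq)
qed

end

section \<open>Currying bimorphisms\<close>

lemma prod_cat_simps [simp]:
  "Obj (prod_cat A B) = Obj A \<times> Obj B"
  "Arr (prod_cat A B) = Arr A \<times> Arr B"
  "Dom (prod_cat A B) (f, g) = (Dom A f, Dom B g)"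
  "Cod (prod_cat A B) (f, g) = (Cod A f, Cod B g)"
  "Idn (prod_cat A B) (a, b) = (Idn A a, Idn B b)"
  "Comp (prod_cat A B) (f', g') (f, g) = (Comp A f' f, Comp B g' g)"
  by (simp_all add: prod_cat_def)

lemma fun_cat_simps [simp]:
  "Obj (fun_cat A C) = {F. is_functor A C F}"
  "Arr (fun_cat A C) = {\<eta>. is_ntrans A C \<eta>}"
  "Dom (fun_cat A C) = ntdom"
  "Cod (fun_cat A C) = ntcod"
  "ntdom (Idn (fun_cat A C) F) = F"
  "ntcod (Idn (fun_cat A C) F) = F"
  "ntmap (Idn (fun_cat A C) F) \<in> extensional (Obj A)"
  "a \<in> Obj A \<Longrightarrow> ntmap (Idn (fun_cat A C) F) a = Idn C (FO F a)"
  "ntdom (Comp (fun_cat A C) \<theta> \<eta>) = ntdom \<eta>"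
  "ntcod (Comp (fun_cat A C) \<theta> \<eta>) = ntcod \<theta>"
  "ntmap (Comp (fun_cat A C) \<theta> \<eta>) \<in> extensional (Obj A)"
  "a \<in> Obj A \<Longrightarrow> ntmap (Comp (fun_cat A C) \<theta> \<eta>) a = Comp C (ntmap \<theta> a) (ntmap \<eta> a)"
  by (simp_all add: fun_cat_def)

lemma fix_snd_simps [simp]:
  "FO (fix_snd A B H b) \<in> extensional (Obj A)" "FA (fix_snd A B H b) \<in> extensional (Arr A)"
  "a \<in> Obj A \<Longrightarrow> FO (fix_snd A B H b) a = FO H (a, b)"
  "f \<in> Arr A \<Longrightarrow> FA (fix_snd A B H b) f = FA H (f, Idn B b)"
  by (simp_all add: fix_snd_def)

lemma uncurry_functor_simps [simp]:
  "FO (uncurry_functor A B C K) \<in> extensional (Obj A \<times> Obj B)"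
  "FA (uncurry_functor A B C K) \<in> extensional (Arr A \<times> Arr B)"
  "\<lbrakk>a \<in> Obj A; b \<in> Obj B\<rbrakk> \<Longrightarrow> FO (uncurry_functor A B C K) (a, b) = FO (FO K b) a"
  "\<lbrakk>f \<in> Arr A; g \<in> Arr B\<rbrakk> \<Longrightarrow> FA (uncurry_functor A B C K) (f, g) =
    Comp C (FA (FO K (Cod B g)) f) (ntmap (FA K g) (Dom A f))"
  by (simp_all add: uncurry_functor_def)

definition slice_ntrans ::
    "('o, 'm, 'z) cat_scheme \<Rightarrow> ('p, 'n, 'y) cat_scheme \<Rightarrow> ('o \<times> 'p, 'm \<times> 'n, 'q, 'l) func
      \<Rightarrow> 'n \<Rightarrow> ('o, 'm, 'q, 'l) ntrans" where
  "slice_ntrans A B H g =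
    \<lparr>ntdom = fix_snd A B H (Dom B g), ntcod = fix_snd A B H (Cod B g),
     ntmap = (\<lambda>a\<in>Obj A. FA H (Idn A a, g))\<rparr>"

lemma slice_ntrans_simps [simp]:
  "ntdom (slice_ntrans A B H g) = fix_snd A B H (Dom B g)"
  "ntcod (slice_ntrans A B H g) = fix_snd A B H (Cod B g)"
  "ntmap (slice_ntrans A B H g) \<in> extensional (Obj A)"
  "a \<in> Obj A \<Longrightarrow> ntmap (slice_ntrans A B H g) a = FA H (Idn A a, g)"
  by (simp_all add: slice_ntrans_def)

text \<open>The counter makes the recursion primitive, as \<open>ft\<close> is an arbitrary function
  on objects. It is always run with the length of \<open>b\<close>, so that the empty list is
  reached exactly at length 0.\<close>

primrec slice_chain ::
    "('o, 'm, 'z) precon_scheme \<Rightarrow> ('p, 'n, 'y) precon_scheme \<Rightarrow> ('o \<times> 'p, 'm \<times> 'n, 'q, 'l) func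
      \<Rightarrow> nat \<Rightarrow> 'p \<Rightarrow> ('o, 'm, 'q, 'l) chain" where
  "slice_chain A B H 0 b = []"
| "slice_chain A B H (Suc n) b = slice_ntrans A B H (proj B b) # slice_chain A B H n (ft B b)"

text \<open>The candidate for the inverse of \<open>bimorphism_of\<close>.\<close>

definition curry_exp ::
    "('o, 'm, 'z) precon_scheme \<Rightarrow> ('p, 'n, 'y) precon_scheme \<Rightarrow> ('o \<times> 'p, 'm \<times> 'n, 'q, 'l) func
      \<Rightarrow> ('p, 'n, ('o, 'm, 'q, 'l) chain, ('o, 'm, 'q, 'l) exp_arr) func" where
  "curry_exp A B H =
    \<lparr>FO = (\<lambda>b\<in>Obj B. slice_chain A B H (len B b) b),
     FA = (\<lambda>g\<in>Arr B. (slice_chain A B H (len B (Dom B g)) (Dom B g),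
                        slice_chain A B H (len B (Cod B g)) (Cod B g), slice_ntrans A B H g))\<rparr>"

locale currying = A: precontextual A + B: precontextual B + C: contextual C
  for A :: "('oa, 'ma, 'za) precon_scheme" and B :: "('ob, 'mb, 'zb) precon_scheme"
    and C :: "('o, 'm, 'z) precon_scheme"
begin

abbreviation "sl \<equiv> slice_ntrans A B"
abbreviation "unc \<equiv> uncurry_functor A B C"

section \<open>Functors into a functor category and functors on a product\<close>

lemma uncurry_is_functor:
  assumes K: "is_functor B (fun_cat A C) K"
  shows "is_functor (prod_cat A B) C (unc K)"
proof -
  note K' = is_functorD[OF K]
  have Fb: "is_functor A C (FO K b)" if "b \<in> Obj B" for b
    using K'(3)[OF that] by simp
  have n: "is_ntrans A C (FA K g)" "ntdom (FA K g) = FO K (Dom B g)" "ntcod (FA K g) = FO K (Cod B g)"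
    if "g \<in> Arr B" for g
    using K'(4-6)[OF that] by simp_all
  have ty: "FA (FO K b) f \<in> Hom C (FO (FO K b) (Dom A f)) (FO (FO K b) (Cod A f))"
    if "b \<in> Obj B" "f \<in> Arr A" for b f
    using is_functorD(4-6)[OF Fb[OF that(1)] that(2)] by (simp add: Hom_def)
  have tn: "ntmap (FA K g) a \<in> Hom C (FO (FO K (Dom B g)) a) (FO (FO K (Cod B g)) a)"
    if "g \<in> Arr B" "a \<in> Obj A" for g a
    using is_ntransD(4-6)[OF n(1)[OF that(1)] that(2)] n(2,3)[OF that(1)] by (simp add: Hom_def)
  have t: "Comp C (FA (FO K (Cod B g)) f) (ntmap (FA K g) (Dom A f)) \<in>
      Hom C (FO (FO K (Dom B g)) (Dom A f)) (FO (FO K (Cod B g)) (Cod A f))"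
    if "f \<in> Arr A" "g \<in> Arr B" for f g
    using that by (intro C.Comp_in[OF tn ty]) (simp_all add: A.Dom_in B.Cod_in)
  have assoc: "Comp C h (Comp C g f) = Comp C (Comp C h g) f"
    if "f \<in> Hom C a b" "g \<in> Hom C b c" "h \<in> Hom C c d" for f g h a b c d
    using that C.Comp_assoc by (auto simp: Hom_def)
  show ?thesis
  proof (rule is_functorI)
    fix x assume "x \<in> Obj (prod_cat A B)"
    then obtain a b where x: "x = (a, b)" "a \<in> Obj A" "b \<in> Obj B" by auto
    then show "FO (unc K) x \<in> Obj C" using is_functorD(3)[OF Fb] by simp
    have "Comp C (Idn C (FO (FO K b) a)) (Idn C (FO (FO K b) a)) = Idn C (FO (FO K b) a)"
      using is_functorD(3)[OF Fb[OF x(3)] x(2)] C.Comp_Idn_right[of "Idn C (FO (FO K b) a)"] by simp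
    then show "FA (unc K) (Idn (prod_cat A B) x) = Idn C (FO (unc K) x)"
      using x is_functorD(7)[OF Fb] K'(7) by simp
  next
    fix x assume "x \<in> Arr (prod_cat A B)"
    then obtain f g where x: "x = (f, g)" "f \<in> Arr A" "g \<in> Arr B" by auto
    then show "FA (unc K) x \<in> Arr C" "Dom C (FA (unc K) x) = FO (unc K) (Dom (prod_cat A B) x)"
      "Cod C (FA (unc K) x) = FO (unc K) (Cod (prod_cat A B) x)"
      using t[OF x(2,3)] by (simp_all add: Hom_def A.Dom_in A.Cod_in B.Dom_in B.Cod_in)
    fix y assume "y \<in> Arr (prod_cat A B)" "Cod (prod_cat A B) x = Dom (prod_cat A B) y"
    then obtain f' g' where y: "y = (f', g')" "f' \<in> Arr A" "g' \<in> Arr B" "Dom A f' = Cod A f" "Dom B g' = Cod B g"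
      using x by auto
    note ob = A.Dom_in[OF x(2)] A.Cod_in[OF x(2)] B.Dom_in[OF x(3)] B.Cod_in[OF x(3)] B.Cod_in[OF y(3)]
    let ?p = "ntmap (FA K g) (Dom A f)" and ?q = "ntmap (FA K g') (Dom A f)"
    let ?q' = "ntmap (FA K g') (Cod A f)"
    let ?r = "FA (FO K (Cod B g')) f" and ?r' = "FA (FO K (Cod B g')) f'" and ?s = "FA (FO K (Cod B g)) f"
    have h: "?p \<in> Hom C (FO (FO K (Dom B g)) (Dom A f)) (FO (FO K (Cod B g)) (Dom A f))"
      "?q \<in> Hom C (FO (FO K (Cod B g)) (Dom A f)) (FO (FO K (Cod B g')) (Dom A f))"
      "?q' \<in> Hom C (FO (FO K (Cod B g)) (Cod A f)) (FO (FO K (Cod B g')) (Cod A f))"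
      "?r \<in> Hom C (FO (FO K (Cod B g')) (Dom A f)) (FO (FO K (Cod B g')) (Cod A f))"
      "?s \<in> Hom C (FO (FO K (Cod B g)) (Dom A f)) (FO (FO K (Cod B g)) (Cod A f))"
      "?r' \<in> Hom C (FO (FO K (Cod B g')) (Cod A f)) (FO (FO K (Cod B g')) (Cod A f'))"
      using tn[OF x(3) ob(1)] tn[OF y(3) ob(1)] tn[OF y(3) ob(2)] ty[OF ob(5) x(2)] ty[OF ob(4) x(2)]
        ty[OF ob(5) y(2)] y by simp_all
    \<comment> \<open>The interchange step: naturality of \<open>FA K g'\<close> at \<open>f\<close>
      exchanges the two middle factors of the fourfold composite below.\<close>
    have nat: "Comp C ?r ?q = Comp C ?q' ?s"
      using is_ntransD(7)[OF n(1)[OF y(3)] x(2)] n(2,3)[OF y(3)] y(5) by simp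
    have "FA (unc K) (Comp (prod_cat A B) y x) = Comp C (Comp C ?r' ?r) (Comp C ?q ?p)"
      using x y ob A.Comp_props[of f f'] B.Comp_props[of g g'] is_functorD(8)[OF Fb[OF ob(5)], of f f'] K'(8)[of g g']
      by simp
    also have "\<dots> = Comp C ?r' (Comp C (Comp C ?r ?q) ?p)"
      using assoc[OF C.Comp_in[OF h(1,2)] h(4,6)] assoc[OF h(1,2,4)] by simp
    also have "\<dots> = Comp C ?r' (Comp C ?q' (Comp C ?s ?p))"
      unfolding nat using assoc[OF h(1,5,3)] by simp
    also have "\<dots> = Comp C (Comp C ?r' ?q') (Comp C ?s ?p)"
      using assoc[OF C.Comp_in[OF h(1,5)] h(3,6)] by simp
    finally show "FA (unc K) (Comp (prod_cat A B) y x) = Comp C (FA (unc K) y) (FA (unc K) x)"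
      using x y by simp
  qed simp_all
qed

text \<open>Together with \<open>slice_uncurry\<close> one half of the isomorphism: \<open>K\<close>
  is recovered from its uncurried form because an identity in one argument drops out of the defining
  composite. The other half is \<open>uncurry_slice\<close>.\<close>

lemma fix_snd_uncurry:
  assumes K: "is_functor B (fun_cat A C) K" and b: "b \<in> Obj B"
  shows "fix_snd A B (unc K) b = FO K b"
proof -
  have F: "is_functor A C (FO K b)"
    using is_functorD(3)[OF K b] by simp
  have "Comp C (FA (FO K b) f) (Idn C (FO (FO K b) (Dom A f))) = FA (FO K b) f" if "f \<in> Arr A" for f
    using is_functorD(4,5)[OF F that] C.Comp_Idn_right[of "FA (FO K b) f"] by simp
  then show ?thesis
    using is_functorD(1,2)[OF F] is_functorD(7)[OF K] b
    by (intro func_eqI[of _ "Obj A" _ "Arr A"]) (simp_all add: A.Dom_in)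
qed

lemma slice_uncurry:
  assumes K: "is_functor B (fun_cat A C) K" and g: "g \<in> Arr B"
  shows "sl (unc K) g = FA K g"
proof -
  have n: "is_ntrans A C (FA K g)" "ntdom (FA K g) = FO K (Dom B g)" "ntcod (FA K g) = FO K (Cod B g)"
    using is_functorD(4-6)[OF K g] by simp_all
  have "is_functor A C (FO K (Cod B g))"
    using is_functorD(3)[OF K B.Cod_in[OF g]] by simp
  then have "Comp C (FA (FO K (Cod B g)) (Idn A a)) (ntmap (FA K g) a) = ntmap (FA K g) a" if "a \<in> Obj A" for a
    using is_ntransD(4-6)[OF n(1) that] C.Comp_Idn_left[of "ntmap (FA K g) a"] n(3) that
    by (simp add: is_functorD(7))
  then show ?thesis
    using n is_ntransD(3)[OF n(1)] fix_snd_uncurry[OF K] g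
    by (intro ntrans_eqI[of _ _ "Obj A"]) (simp_all add: B.Dom_in B.Cod_in)
qed

section \<open>Slices of a functor on a product\<close>

context
  fixes H
  assumes H: "is_functor (prod_cat A B) C H"
begin

text \<open>The functor law for pairs, oriented so that composites merge into a single value of
  \<open>H\<close>; equations between composites then come down to identity laws in \<open>A\<close>
  and \<open>B\<close>.\<close>

lemma H_Comp:
  "\<lbrakk>f \<in> Arr A; f' \<in> Arr A; Cod A f = Dom A f'; g \<in> Arr B; g' \<in> Arr B; Cod B g = Dom B g'\<rbrakk>
    \<Longrightarrow> Comp C (FA H (f', g')) (FA H (f, g)) = FA H (Comp A f' f, Comp B g' g)"
  using is_functorD(8)[OF H, of "(f, g)" "(f', g')"] by simp

lemma H_typ:
  "\<lbrakk>f \<in> Arr A; g \<in> Arr B\<rbrakk> \<Longrightarrow>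
    FA H (f, g) \<in> Hom C (FO H (Dom A f, Dom B g)) (FO H (Cod A f, Cod B g))"
  using is_functorD(4-6)[OF H, of "(f, g)"] by (simp add: Hom_def)

lemma H_Idn: "\<lbrakk>a \<in> Obj A; b \<in> Obj B\<rbrakk> \<Longrightarrow> FA H (Idn A a, Idn B b) = Idn C (FO H (a, b))"
  using is_functorD(7)[OF H, of "(a, b)"] by simp

lemma fix_snd_is_functor:
  assumes "b \<in> Obj B"
  shows "is_functor A C (fix_snd A B H b)"
proof -
  have "Comp B (Idn B b) (Idn B b) = Idn B b"
    using B.Comp_Idn_left[of "Idn B b"] assms by simp
  then show ?thesis
    using H_typ[of _ "Idn B b"] is_functorD(3)[OF H] assms
    by (intro is_functorI) (auto simp: H_Idn H_Comp A.Dom_in A.Cod_in A.Comp_props Hom_def)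
qed

text \<open>Both ways around the naturality square at \<open>f\<close> merge into
  \<open>FA H (f, g)\<close>.\<close>

lemma slice_is_ntrans:
  assumes g: "g \<in> Arr B"
  shows "is_ntrans A C (sl H g)"
proof -
  have "FA H (Idn A a, g) \<in> Hom C (FO H (a, Dom B g)) (FO H (a, Cod B g))" if "a \<in> Obj A" for a
    using H_typ[of "Idn A a" g] g that by simp
  then show ?thesis
    using fix_snd_is_functor g
    by (simp add: is_ntrans_def A.Dom_in A.Cod_in B.Dom_in B.Cod_in H_Comp
        A.Comp_Idn_left A.Comp_Idn_right B.Comp_Idn_left B.Comp_Idn_right)
qed

lemma slice_Idn: "b \<in> Obj B \<Longrightarrow> sl H (Idn B b) = Idn (fun_cat A C) (fix_snd A B H b)"
  by (intro ntrans_eqI[of _ _ "Obj A"]) (simp_all add: H_Idn)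

lemma slice_Comp:
  assumes "g \<in> Arr B" "g' \<in> Arr B" "Cod B g = Dom B g'"
  shows "sl H (Comp B g' g) = Comp (fun_cat A C) (sl H g') (sl H g)"
proof -
  have "Comp A (Idn A a) (Idn A a) = Idn A a" if "a \<in> Obj A" for a
    using that A.Comp_Idn_left[of "Idn A a"] by simp
  then show ?thesis
    using assms by (intro ntrans_eqI[of _ _ "Obj A"]) (simp_all add: H_Comp B.Comp_props)
qed

text \<open>Rests on writing \<open>(f, g)\<close> as \<open>f\<close> paired with an identity after
  an identity paired with \<open>g\<close>, which is the order of composition in
  \<open>uncurry_functor\<close>.\<close>

lemma uncurry_slice:
  assumes "FO K \<in> extensional (Obj B)" "FA K \<in> extensional (Arr B)"
    and "\<And>b. b \<in> Obj B \<Longrightarrow> FO K b = fix_snd A B H b" "\<And>g. g \<in> Arr B \<Longrightarrow> FA K g = sl H g"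
  shows "unc K = H"
  using is_functorD(1,2)[OF H] assms(3,4)
  by (intro func_eqI[of _ "Obj A \<times> Obj B" _ "Arr A \<times> Arr B"])
    (auto simp: H_Comp A.Dom_in B.Cod_in A.Comp_Idn_right B.Comp_Idn_left)

lemma nat_square_slice:
  "\<lbrakk>f \<in> Arr A; g \<in> Arr B\<rbrakk> \<Longrightarrow> nat_square A (sl H g) f = bi_square A B H f g"
  by (simp add: nat_square_def bi_square_def A.Dom_in A.Cod_in)

lemma indexed_sort_slice:
  assumes D: "\<And>b. b \<in> Obj B \<Longrightarrow> D_functor A C (fix_snd A B H b)"
    and b: "b \<in> Obj B" "len B b \<ge> 1"
  shows "indexed_sort A C (sl H (proj B b)) \<longleftrightarrow>
     (\<forall>a\<in>Obj A. len A a \<ge> 1 \<longrightarrow> rel_display1 C (bi_square A B H (proj A a) (proj B b))) \<and>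
     (\<forall>S\<in>QSq A. distinguished C
        (gap_square C
           (bi_square A B H (Left S) (proj B b)) (bi_square A B H (Right S) (proj B b))
           (FA H (Top S, Idn B b)) (FA H (Bottom S, Idn B b)) (FA H (Top S, Idn B (ft B b)))))"
proof -
  note p = B.proj_props[OF b]
  have "sl H (proj B b) \<in> Arr (D_cat A C)"
    using D slice_is_ntrans p b(1) by (simp add: Arr_D_cat B.ft_in)
  moreover have "Top S \<in> Arr A \<and> Left S \<in> Arr A \<and> Right S \<in> Arr A \<and> Bottom S \<in> Arr A" if "S \<in> QSq A" for S
    using A.QSq_comm[OF that] by (simp add: comm_square_def)
  ultimately show ?thesis
    using p by (simp add: indexed_sort_def nat_square_slice A.proj_props)
qed

text \<open>Two clauses of \<open>indexed_dist_square\<close> come for free: the square of slices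
  commutes by functoriality of \<open>H\<close>, and its vertical sides are slices at projections,
  hence sorts by \<open>sort\<close>. Only the gap squares remain.\<close>

lemma indexed_dist_square_slice:
  assumes D: "\<And>b. b \<in> Obj B \<Longrightarrow> D_functor A C (fix_snd A B H b)"
    and sort: "\<And>b. \<lbrakk>b \<in> Obj B; len B b \<ge> 1\<rbrakk> \<Longrightarrow> indexed_sort A C (sl H (proj B b))"
    and S: "S \<in> QSq B"
  shows "indexed_dist_square A C (map_square (sl H) S) \<longleftrightarrow>
     (\<forall>a\<in>Obj A. len A a \<ge> 1 \<longrightarrow> distinguished C
        (gap_square C
           (bi_square A B H (proj A a) (Left S)) (bi_square A B H (proj A a) (Right S))
           (FA H (Idn A a, Top S)) (FA H (Idn A (ft A a), Top S)) (FA H (Idn A a, Bottom S))))"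
proof -
  have c: "Top S \<in> Arr B" "Left S \<in> Arr B" "Right S \<in> Arr B" "Bottom S \<in> Arr B"
    "Dom B (Top S) = Dom B (Left S)" "Cod B (Top S) = Dom B (Right S)"
    "Cod B (Left S) = Dom B (Bottom S)" "Cod B (Right S) = Cod B (Bottom S)"
    "Comp B (Right S) (Top S) = Comp B (Bottom S) (Left S)"
    using B.QSq_comm[OF S] by (auto simp: comm_square_def)
  have "sl H g \<in> Arr (D_cat A C)" if "g \<in> Arr B" for g
    using D slice_is_ntrans that by (simp add: Arr_D_cat B.Dom_in B.Cod_in)
  then have "comm_square (D_cat A C) (map_square (sl H) S)"
    using c by (simp add: comm_square_D_cat square.map_sel H_Comp)
  moreover have "indexed_sort A C (sl H (Left S))" "indexed_sort A C (sl H (Right S))"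
    using B.QSq_Left[OF S] B.QSq_Right[OF S] sort by auto
  ultimately show ?thesis
    using c by (simp add: indexed_dist_square_def square.map_sel nat_square_slice A.proj_props A.ft_in)
qed

end

lemma bimorphism_iff:
  "bimorphism A B C H \<longleftrightarrow>
     is_functor (prod_cat A B) C H \<and>
     (\<forall>b\<in>Obj B. D_functor A C (fix_snd A B H b) \<and>
        (len B b = 0 \<longrightarrow> fix_snd A B H b = const_functor A C (one C))) \<and>
     (\<forall>b\<in>Obj B. len B b \<ge> 1 \<longrightarrow> indexed_sort A C (sl H (proj B b))) \<and>
     (\<forall>S\<in>QSq B. indexed_dist_square A C (map_square (sl H) S))" (is "_ \<longleftrightarrow> ?H \<and> ?D \<and> ?s \<and> ?q")
\<comment> \<open>Slices lie in \<open>D_cat\<close> only under these two clauses; where they fail,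
  both sides are false, as they have the clauses in common.\<close>
proof (cases "?H \<and> ?D")
  case True
  then have H: ?H and D: "\<And>b. b \<in> Obj B \<Longrightarrow> D_functor A C (fix_snd A B H b)" by auto
  have s: "?s \<longleftrightarrow> (\<forall>a\<in>Obj A. \<forall>b\<in>Obj B. len A a \<ge> 1 \<and> len B b \<ge> 1 \<longrightarrow>
        rel_display1 C (bi_square A B H (proj A a) (proj B b))) \<and>
     (\<forall>b\<in>Obj B. \<forall>S\<in>QSq A. len B b \<ge> 1 \<longrightarrow> distinguished C
        (gap_square C
           (bi_square A B H (Left S) (proj B b)) (bi_square A B H (Right S) (proj B b))
           (FA H (Top S, Idn B b)) (FA H (Bottom S, Idn B b)) (FA H (Top S, Idn B (ft B b)))))"
    using indexed_sort_slice[OF H D] by (simp only: cong: conj_cong ball_cong) blast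
  \<comment> \<open>Conditional on \<open>?s\<close>, since an indexed distinguished square must
    have indexed sorts as its vertical sides.\<close>
  have q: "?q \<longleftrightarrow> (\<forall>a\<in>Obj A. \<forall>S\<in>QSq B. len A a \<ge> 1 \<longrightarrow> distinguished C
        (gap_square C
           (bi_square A B H (proj A a) (Left S)) (bi_square A B H (proj A a) (Right S))
           (FA H (Idn A a, Top S)) (FA H (Idn A (ft A a), Top S)) (FA H (Idn A a, Bottom S))))" if ?s
    using indexed_dist_square_slice[OF H D] that by blast
  have "bimorphism A B C H \<longleftrightarrow> ?s \<and> (\<forall>a\<in>Obj A. \<forall>S\<in>QSq B. len A a \<ge> 1 \<longrightarrow> distinguished C
        (gap_square C
           (bi_square A B H (proj A a) (Left S)) (bi_square A B H (proj A a) (Right S))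
           (FA H (Idn A a, Top S)) (FA H (Idn A (ft A a), Top S)) (FA H (Idn A a, Bottom S))))"
    unfolding bimorphism_def s using True by blast
  then show ?thesis
    using q True by blast
qed (auto simp: bimorphism_def)

section \<open>From contextual functors to bimorphisms\<close>

lemma heart_simps [simp]:
  "is_chain A C c \<Longrightarrow> FO (heart A C) c = chain_top A C c"
  "(c, d, \<eta>) \<in> exp_arrows A C \<Longrightarrow> FA (heart A C) (c, d, \<eta>) = \<eta>"
  by (simp_all add: heart_def)

lemma heart_comp_is_functor:
  assumes F: "is_functor B (exponential A C) F"
  shows "is_functor B (fun_cat A C) (comp_functor B (heart A C) F)"
proof (rule is_functorI)
  note F' = is_functorD[OF F]
  have ob: "is_chain A C (FO F b)" if "b \<in> Obj B" for b
    using F'(3)[OF that] by simp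
  fix b assume b: "b \<in> Obj B"
  have f: "is_functor A C (chain_top A C (FO F b))"
    using chain_top_functor[OF A.precontextual_axioms C.contextual_axioms ob[OF b]] .
  then show "FO (comp_functor B (heart A C) F) b \<in> Obj (fun_cat A C)"
    using b ob by simp
  have "(FO F b, FO F b, Idn (fun_cat A C) (chain_top A C (FO F b))) \<in> exp_arrows A C"
    using ob[OF b] Idn_fun_cat_is_ntrans[OF A.category_axioms C.category_axioms f]
    by (simp add: exp_arrows_iff)
  then show "FA (comp_functor B (heart A C) F) (Idn B b) = Idn (fun_cat A C) (FO (comp_functor B (heart A C) F) b)"
    using b ob by (simp add: F')
next
  note F' = is_functorD[OF F]
  have ar: "\<exists>\<eta>. FA F g = (FO F (Dom B g), FO F (Cod B g), \<eta>) \<and> (FO F (Dom B g), FO F (Cod B g), \<eta>) \<in> exp_arrows A C"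
    if "g \<in> Arr B" for g
    using F'(4-6)[OF that] by (cases "FA F g") auto
  fix g assume g: "g \<in> Arr B"
  obtain \<eta> where \<eta>: "FA F g = (FO F (Dom B g), FO F (Cod B g), \<eta>)" "(FO F (Dom B g), FO F (Cod B g), \<eta>) \<in> exp_arrows A C"
    using ar[OF g] by blast
  then show "FA (comp_functor B (heart A C) F) g \<in> Arr (fun_cat A C)"
    "Dom (fun_cat A C) (FA (comp_functor B (heart A C) F) g) = FO (comp_functor B (heart A C) F) (Dom B g)"
    "Cod (fun_cat A C) (FA (comp_functor B (heart A C) F) g) = FO (comp_functor B (heart A C) F) (Cod B g)"
    using g by (auto simp: exp_arrows_iff B.Dom_in B.Cod_in)
  fix g' assume g': "g' \<in> Arr B" "Cod B g = Dom B g'"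
  obtain \<theta> where \<theta>: "FA F g' = (FO F (Dom B g'), FO F (Cod B g'), \<theta>)" "(FO F (Dom B g'), FO F (Cod B g'), \<theta>) \<in> exp_arrows A C"
    using ar[OF g'(1)] by blast
  have "FA F (Comp B g' g) = (FO F (Dom B g), FO F (Cod B g'), Comp (fun_cat A C) \<theta> \<eta>)"
    using F'(8)[OF g g'] \<eta>(1) \<theta>(1) by simp
  moreover have "FA F (Comp B g' g) \<in> exp_arrows A C"
    using F'(4)[of "Comp B g' g"] g g' by (simp add: B.Comp_props)
  ultimately show "FA (comp_functor B (heart A C) F) (Comp B g' g) =
      Comp (fun_cat A C) (FA (comp_functor B (heart A C) F) g') (FA (comp_functor B (heart A C) F) g)"
    using g g' \<eta> \<theta> by (simp add: B.Comp_props)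
qed simp_all

text \<open>The first two components of an arrow of the exponential are its endpoints, hence fixed
  by \<open>F\<close> on objects. The third is the value of the composite with \<open>heart\<close>,
  which \<open>slice_uncurry\<close> reads off from the uncurried functor.\<close>

lemma ctx_functor_arrow:
  assumes F: "ctx_functor B (exponential A C) F" and g: "g \<in> Arr B"
  shows "FA F g = (FO F (Dom B g), FO F (Cod B g), sl (bimorphism_of A B C F) g)" (is ?eq)
    and "(FO F (Dom B g), FO F (Cod B g), sl (bimorphism_of A B C F) g) \<in> exp_arrows A C"
proof -
  note F' = is_functorD[OF ctx_functorD(1)[OF F]]
  obtain \<eta> where \<eta>: "FA F g = (FO F (Dom B g), FO F (Cod B g), \<eta>)" "FA F g \<in> exp_arrows A C"
    using F'(4-6)[OF g] by (cases "FA F g") auto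
  have "sl (bimorphism_of A B C F) g = \<eta>"
    unfolding bimorphism_of_def slice_uncurry[OF heart_comp_is_functor[OF ctx_functorD(1)[OF F]] g]
    using g \<eta> by simp
  then show ?eq "(FO F (Dom B g), FO F (Cod B g), sl (bimorphism_of A B C F) g) \<in> exp_arrows A C"
    using \<eta> by auto
qed

lemma fix_snd_bimorphism_of:
  assumes F: "ctx_functor B (exponential A C) F" and b: "b \<in> Obj B"
  shows "fix_snd A B (bimorphism_of A B C F) b = chain_top A C (FO F b)" "is_chain A C (FO F b)"
proof -
  show c: "is_chain A C (FO F b)"
    using is_functorD(3)[OF ctx_functorD(1)[OF F] b] by simp
  show "fix_snd A B (bimorphism_of A B C F) b = chain_top A C (FO F b)"
    unfolding bimorphism_of_def fix_snd_uncurry[OF heart_comp_is_functor[OF ctx_functorD(1)[OF F]] b]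
    using b c by simp
qed

text \<open>The head is found by comparing two expressions for \<open>FA F (proj B b)\<close>:
  preservation of projections makes its third component the head of the chain, and
  \<open>ctx_functor_arrow\<close> makes it a slice.\<close>

lemma ctx_functor_Cons:
  assumes F: "ctx_functor B (exponential A C) F" and b: "b \<in> Obj B" "len B b \<ge> 1"
  shows "FO F b = sl (bimorphism_of A B C F) (proj B b) # FO F (ft B b)"
proof -
  have "length (FO F b) \<ge> 1" "tl (FO F b) = FO F (ft B b)" "FA F (proj B b) = chain_proj (FO F b)"
    using ctx_functorD(2-4)[OF F b(1)] b(2) by simp_all
  then show ?thesis
    using ctx_functor_arrow(1)[OF F, of "proj B b"] B.proj_props[OF b]
    by (cases "FO F b") (auto simp: chain_proj_def)
qed

lemma bimorphism_of_bimorphism: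
  assumes F: "ctx_functor B (exponential A C) F"
  shows "bimorphism A B C (bimorphism_of A B C F)"
  unfolding bimorphism_iff
proof (intro conjI ballI impI)
  show "is_functor (prod_cat A B) C (bimorphism_of A B C F)"
    unfolding bimorphism_of_def
    by (intro uncurry_is_functor heart_comp_is_functor ctx_functorD(1)[OF F])
  fix b assume b: "b \<in> Obj B"
  show "D_functor A C (fix_snd A B (bimorphism_of A B C F) b)"
    using fix_snd_bimorphism_of[OF F b]
    by (simp add: chain_top_D_functor[OF A.precontextual_axioms C.contextual_axioms])
  show "fix_snd A B (bimorphism_of A B C F) b = const_functor A C (one C)" if "len B b = 0"
    using fix_snd_bimorphism_of(1)[OF F b] ctx_functorD(2)[OF F b] that by simp
  \<comment> \<open>The slice in question is the head of the valid chain
    \<open>FO F b\<close>.\<close>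
  show "indexed_sort A C (sl (bimorphism_of A B C F) (proj B b))" if "len B b \<ge> 1"
    using fix_snd_bimorphism_of(2)[OF F b] ctx_functor_Cons[OF F b that] by simp
next
  fix S assume S: "S \<in> QSq B"
  have c: "Top S \<in> Arr B" "Left S \<in> Arr B" "Right S \<in> Arr B" "Bottom S \<in> Arr B"
    using B.QSq_comm[OF S] by (auto simp: comm_square_def)
  show "indexed_dist_square A C (map_square (sl (bimorphism_of A B C F)) S)"
    using ctx_functorD(5)[OF F S] c ctx_functor_arrow(1)[OF F]
    by (cases S) (auto simp: QSq_exponential chain_proj_def)
qed

section \<open>From bimorphisms to contextual functors\<close>

lemma slice_chain_props:
  assumes "bimorphism A B C H" "b \<in> Obj B" "len B b = n"
  shows "is_chain A C (slice_chain A B H n b)" "chain_top A C (slice_chain A B H n b) = fix_snd A B H b"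
    "length (slice_chain A B H n b) = n"
proof -
  \<comment> \<open>The claims are proved jointly: validity requires the codomain of the new sort to
    be the top of the remaining chain, which is the claim on \<open>chain_top\<close> at
    \<open>ft B b\<close>. At length 0 that top is the implicit constant functor, as a bimorphism
    prescribes.\<close>
  have "is_chain A C (slice_chain A B H n b) \<and> chain_top A C (slice_chain A B H n b) = fix_snd A B H b \<and>
    length (slice_chain A B H n b) = n"
    using assms(2,3)
  proof (induction n arbitrary: b)
    case 0
    then show ?case using assms(1) by (simp add: bimorphism_def)
  next
    case (Suc n)
    then have "len B b \<ge> 1" "ft B b \<in> Obj B" "len B (ft B b) = n"
      using B.len_ft B.ft_in by auto
    then show ?case
      using Suc assms(1) by (simp add: bimorphism_iff B.proj_props)
  qed
  then show "is_chain A C (slice_chain A B H n b)" "chain_top A C (slice_chain A B H n b) = fix_snd A B H b"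
    "length (slice_chain A B H n b) = n" by simp_all
qed

text \<open>Length 0 is covered by the conventions \<open>ft B b = b\<close> and
  \<open>tl [] = []\<close>; \<open>ctx_functor\<close> asks for preservation of \<open>ft\<close>
  at every length.\<close>

lemma slice_chain_ft:
  assumes "b \<in> Obj B"
  shows "slice_chain A B H (len B (ft B b)) (ft B b) = tl (slice_chain A B H (len B b) b)"
  using assms B.ft_zero[OF assms] B.len_ft[OF assms] by (cases "len B b") auto

lemma curry_exp_simps [simp]:
  "FO (curry_exp A B H) \<in> extensional (Obj B)" "FA (curry_exp A B H) \<in> extensional (Arr B)"
  "b \<in> Obj B \<Longrightarrow> FO (curry_exp A B H) b = slice_chain A B H (len B b) b"
  "g \<in> Arr B \<Longrightarrow> FA (curry_exp A B H) g = (slice_chain A B H (len B (Dom B g)) (Dom B g),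
      slice_chain A B H (len B (Cod B g)) (Cod B g), sl H g)"
  by (simp_all add: curry_exp_def)

lemma curry_exp_ctx_functor:
  assumes bi: "bimorphism A B C H"
  shows "ctx_functor B (exponential A C) (curry_exp A B H)"
proof -
  note ch = slice_chain_props[OF bi _ refl]
  have H: "is_functor (prod_cat A B) C H"
    using bi by (simp add: bimorphism_def)
  have arr: "FA (curry_exp A B H) g \<in> exp_arrows A C" if "g \<in> Arr B" for g
    using that ch slice_is_ntrans[OF H that] by (simp add: exp_arrows_iff B.Dom_in B.Cod_in)
  have "is_functor B (exponential A C) (curry_exp A B H)"
    using ch arr slice_Idn[OF H] slice_Comp[OF H]
    by (intro is_functorI) (simp_all add: B.Dom_in B.Cod_in B.Comp_props)
  moreover have pr: "FA (curry_exp A B H) (proj B b) = chain_proj (FO (curry_exp A B H) b)"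
    if b: "b \<in> Obj B" "len B b \<ge> 1" for b
  proof -
    obtain n where "len B b = Suc n"
      using b(2) by (cases "len B b") auto
    then show ?thesis
      using b slice_chain_ft[OF b(1)] by (simp add: B.proj_props chain_proj_def)
  qed
  moreover have "map_square (FA (curry_exp A B H)) S \<in> QSq (exponential A C)" if S: "S \<in> QSq B" for S
  proof -
    obtain a where a: "a \<in> Obj B" "len B a \<ge> 1" "Left S = proj B a" using B.QSq_Left[OF S] by blast
    obtain b where b: "b \<in> Obj B" "len B b \<ge> 1" "Right S = proj B b" using B.QSq_Right[OF S] by blast
    let ?c = "slice_chain A B H (len B a) a" and ?d = "slice_chain A B H (len B b) b"
    have c: "Top S \<in> Arr B" "Bottom S \<in> Arr B" "Dom B (Top S) = a" "Cod B (Top S) = b"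
      "Dom B (Bottom S) = ft B a" "Cod B (Bottom S) = ft B b"
      using B.QSq_comm[OF S] B.proj_props[OF a(1,2)] B.proj_props[OF b(1,2)] a(3) b(3)
      by (auto simp: comm_square_def)
    have nz: "?c \<noteq> []" "?d \<noteq> []" and hd: "hd ?c = sl H (proj B a)" "hd ?d = sl H (proj B b)"
      using a b by (auto simp: Suc_le_eq gr0_conv_Suc)
    have "indexed_dist_square A C (map_square (sl H) S)"
      using bi S by (simp add: bimorphism_iff)
    then have "indexed_dist_square A C (Square (sl H (Top S)) (hd ?c) (hd ?d) (sl H (Bottom S)))"
      using a b hd by (cases S) simp
    moreover have "map_square (FA (curry_exp A B H)) S =
        Square (?c, ?d, sl H (Top S)) (chain_proj ?c) (chain_proj ?d) (tl ?c, tl ?d, sl H (Bottom S))"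
      using pr[OF a(1,2)] pr[OF b(1,2)] a b c slice_chain_ft[OF a(1), of H] slice_chain_ft[OF b(1), of H]
      by (cases S) simp
    moreover have "(?c, ?d, sl H (Top S)) \<in> exp_arrows A C" "(tl ?c, tl ?d, sl H (Bottom S)) \<in> exp_arrows A C"
      using arr[OF c(1)] arr[OF c(2)] c a b slice_chain_ft[OF a(1), of H] slice_chain_ft[OF b(1), of H]
      by simp_all
    ultimately show ?thesis
      using nz by (auto simp: QSq_exponential)
  qed
  ultimately show ?thesis
    using ch slice_chain_ft[of _ H] by (simp add: ctx_functor_def B.ft_in)
qed

lemma bimorphism_of_curry_exp:
  assumes bi: "bimorphism A B C H"
  shows "bimorphism_of A B C (curry_exp A B H) = H"
proof -
  have H: "is_functor (prod_cat A B) C H"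
    using bi by (simp add: bimorphism_def)
  \<comment> \<open>Membership in \<open>exp_arrows\<close> is what allows \<open>heart\<close>,
    which is \<open>undefined\<close> elsewhere, to be evaluated on the triple.\<close>
  have "FA (curry_exp A B H) g \<in> exp_arrows A C" if "g \<in> Arr B" for g
    using is_functorD(4)[OF ctx_functorD(1)[OF curry_exp_ctx_functor[OF bi]] that] by simp
  then show ?thesis
    unfolding bimorphism_of_def
    using slice_chain_props[OF bi _ refl] by (intro uncurry_slice[OF H]) simp_all
qed

lemma curry_exp_bimorphism_of:
  assumes F: "ctx_functor B (exponential A C) F"
  shows "curry_exp A B (bimorphism_of A B C F) = F"
proof -
  let ?H = "bimorphism_of A B C F"
  \<comment> \<open>Induction on the length: at length 0 the chain has no entries, and above it
    \<open>ctx_functor_Cons\<close> peels off one slice. On arrows \<open>ctx_functor_arrow\<close>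
    already gives the triple.\<close>
  have ob: "slice_chain A B ?H n b = FO F b" if "b \<in> Obj B" "len B b = n" for n b
    using that
  proof (induction n arbitrary: b)
    case 0
    then show ?case using ctx_functorD(2)[OF F, of b] by simp
  next
    case (Suc n)
    then have "len B b \<ge> 1" "ft B b \<in> Obj B" "len B (ft B b) = n"
      using B.len_ft B.ft_in by auto
    then show ?case
      using Suc ctx_functor_Cons[OF F] by simp
  qed
  show ?thesis
    using is_functorD(1,2)[OF ctx_functorD(1)[OF F]] ctx_functor_arrow(1)[OF F] ob
    by (intro func_eqI[of _ "Obj B" _ "Arr B"]) (simp_all add: B.Dom_in B.Cod_in)
qed

lemma bimorphism_of_bij:
  "bij_betw (bimorphism_of A B C) {F. ctx_functor B (exponential A C) F} {H. bimorphism A B C H}"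
  by (rule bij_betw_byWitness[where f' = "curry_exp A B"])
    (auto simp: curry_exp_bimorphism_of bimorphism_of_curry_exp bimorphism_of_bimorphism curry_exp_ctx_functor)

end

section \<open>Naturality\<close>

lemma prod_functor_simps [simp]:
  "\<lbrakk>a \<in> Obj A; b \<in> Obj B\<rbrakk> \<Longrightarrow> FO (prod_functor A B U V) (a, b) = (FO U a, FO V b)"
  "\<lbrakk>f \<in> Arr A; g \<in> Arr B\<rbrakk> \<Longrightarrow> FA (prod_functor A B U V) (f, g) = (FA U f, FA V g)"
  by (simp_all add: prod_functor_def)

lemma bi_action_simps [simp]:
  "FO (bi_action A' B' U V W H) \<in> extensional (Obj A' \<times> Obj B')"
  "FA (bi_action A' B' U V W H) \<in> extensional (Arr A' \<times> Arr B')"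
  "\<lbrakk>a \<in> Obj A'; b \<in> Obj B'\<rbrakk> \<Longrightarrow> FO (bi_action A' B' U V W H) (a, b) = FO W (FO H (FO U a, FO V b))"
  "\<lbrakk>f \<in> Arr A'; g \<in> Arr B'\<rbrakk> \<Longrightarrow> FA (bi_action A' B' U V W H) (f, g) = FA W (FA H (FA U f, FA V g))"
  using comp_functor_ext[of "prod_cat A' B'"] by (simp_all add: bi_action_def)

lemma exp_action_simps [simp]:
  "FO (exp_action A' B' A C U V W F) \<in> extensional (Obj B')"
  "FA (exp_action A' B' A C U V W F) \<in> extensional (Arr B')"
  "b \<in> Obj B' \<Longrightarrow> FO (exp_action A' B' A C U V W F) b = FO (exp_map A' A C U W) (FO F (FO V b))"
  "g \<in> Arr B' \<Longrightarrow> FA (exp_action A' B' A C U V W F) g = FA (exp_map A' A C U W) (FA F (FA V g))"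
  by (simp_all add: exp_action_def)

text \<open>Composite functors are restricted to the carrier of their source; the hypotheses keep
  every intermediate value inside these carriers, where the restriction is invisible.\<close>

lemma whisker_functor_comp:
  assumes "is_functor A'' A' U'" "is_functor A' A U" "is_functor A C F"
  shows "whisker_functor A'' (comp_functor A'' U U') (comp_functor C W' W) F =
    whisker_functor A'' U' W' (whisker_functor A' U W F)"
  using is_functorD(3,4)[OF assms(1)] is_functorD(3,4)[OF assms(2)] is_functorD(3,4)[OF assms(3)]
  by (intro func_eqI[of _ "Obj A''" _ "Arr A''"]) simp_all

lemma whisker_ntrans_comp:
  assumes "is_functor A'' A' U'" "is_functor A' A U" "is_ntrans A C \<eta>"
  shows "whisker_ntrans A'' (comp_functor A'' U U') (comp_functor C W' W) \<eta> =
    whisker_ntrans A'' U' W' (whisker_ntrans A' U W \<eta>)"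
  using is_functorD(3)[OF assms(1)] is_functorD(3)[OF assms(2)] is_ntransD(4)[OF assms(3)]
    whisker_functor_comp[OF assms(1,2)] is_ntransD(1,2)[OF assms(3)]
  by (intro ntrans_eqI[of _ _ "Obj A''"]) simp_all

lemma whisker_functor_id:
  assumes "is_functor A C F"
  shows "whisker_functor A (id_functor A) (id_functor C) F = F"
  using is_functorD[OF assms] by (intro func_eqI[of _ "Obj A" _ "Arr A"]) simp_all

lemma whisker_ntrans_id:
  assumes "is_ntrans A C \<eta>"
  shows "whisker_ntrans A (id_functor A) (id_functor C) \<eta> = \<eta>"
  using is_ntransD[OF assms] whisker_functor_id
  by (intro ntrans_eqI[of _ _ "Obj A"]) simp_all

lemma is_chain_ntrans: "\<lbrakk>is_chain A C c; \<pi> \<in> set c\<rbrakk> \<Longrightarrow> is_ntrans A C \<pi>"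
  by (induction c) (auto simp: indexed_sort_def Arr_D_cat)

context currying
begin

lemma bimorphism_of_simps:
  assumes F: "ctx_functor B (exponential A C) F"
  shows "\<lbrakk>a \<in> Obj A; b \<in> Obj B\<rbrakk> \<Longrightarrow> FO (bimorphism_of A B C F) (a, b) = FO (chain_top A C (FO F b)) a"
    and "\<lbrakk>f \<in> Arr A; g \<in> Arr B; FA F g = (c, d, \<eta>)\<rbrakk> \<Longrightarrow>
      FA (bimorphism_of A B C F) (f, g) = Comp C (FA (chain_top A C d) f) (ntmap \<eta> (Dom A f))"
proof -
  note F' = is_functorD[OF ctx_functorD(1)[OF F]]
  show "FO (bimorphism_of A B C F) (a, b) = FO (chain_top A C (FO F b)) a" if "a \<in> Obj A" "b \<in> Obj B"
    using that F'(3)[OF that(2)] by (simp add: bimorphism_of_def)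
  show "FA (bimorphism_of A B C F) (f, g) = Comp C (FA (chain_top A C d) f) (ntmap \<eta> (Dom A f))"
    if "f \<in> Arr A" "g \<in> Arr B" "FA F g = (c, d, \<eta>)"
  proof -
    have "FO F (Cod B g) = d" "is_chain A C d" "(c, d, \<eta>) \<in> exp_arrows A C"
      using F'(4,6)[OF that(2)] that(3) by (auto simp: exp_arrows_iff)
    then show ?thesis
      using that by (simp add: bimorphism_of_def B.Cod_in)
  qed
qed

end

context whiskering
begin

context
  fixes B :: "('ob, 'mb, 'zb) precon_scheme" and B' :: "('ob1, 'mb1, 'zb1) precon_scheme"
    and V :: "('ob1, 'mb1, 'ob, 'mb) func"
  assumes B: "precontextual B" and B': "precontextual B'" and V: "ctx_functor B' B V"
begin

lemma exp_action_ctx_functor: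
  assumes F: "ctx_functor B (exponential A C) F"
  shows "ctx_functor B' (exponential A' C') (exp_action A' B' A C U V W F)"
  unfolding exp_action_def
  using precontextual.ctx_functor_comp[OF B' precontextual.ctx_functor_comp[OF B' V F] exp_map_ctx_functor] .

text \<open>At \<open>(f, g)\<close> both sides come from one composite in \<open>C\<close>, taken
  at \<open>FA U f\<close> and \<open>FA V g\<close>: on the left \<open>W\<close> is applied to its
  two factors, on the right to the composite itself.\<close>

lemma bimorphism_of_exp_action:
  assumes F: "ctx_functor B (exponential A C) F"
  shows "bimorphism_of A' B' C' (exp_action A' B' A C U V W F) = bi_action A' B' U V W (bimorphism_of A B C F)"
proof -
  interpret B: precontextual B by (rule B)
  interpret B': precontextual B' by (rule B')
  interpret X: currying A B C ..
  interpret X': currying A' B' C' ..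
  note F' = is_functorD[OF ctx_functorD(1)[OF F]] and V' = is_functorD[OF ctx_functorD(1)[OF V]]
  note E = exp_action_ctx_functor[OF F]
  show ?thesis
  proof (rule func_eqI)
    show "FO (bimorphism_of A' B' C' (exp_action A' B' A C U V W F)) \<in> extensional (Obj A' \<times> Obj B')"
      "FA (bimorphism_of A' B' C' (exp_action A' B' A C U V W F)) \<in> extensional (Arr A' \<times> Arr B')"
      by (simp_all add: bimorphism_of_def)
    fix x assume "x \<in> Obj A' \<times> Obj B'"
    then obtain a b where x: "x = (a, b)" "a \<in> Obj A'" "b \<in> Obj B'" by auto
    have "is_chain A C (FO F (FO V b))"
      using F'(3)[OF V'(3)[OF x(3)]] by simp
    then show "FO (bimorphism_of A' B' C' (exp_action A' B' A C U V W F)) x =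
        FO (bi_action A' B' U V W (bimorphism_of A B C F)) x"
      using x by (simp add: X'.bimorphism_of_simps(1)[OF E] X.bimorphism_of_simps(1)[OF F]
          fun_U V' whisker_chain_top)
  next
    fix x assume "x \<in> Arr A' \<times> Arr B'"
    then obtain f g where x: "x = (f, g)" "f \<in> Arr A'" "g \<in> Arr B'" by auto
    obtain c d \<eta> where g: "FA F (FA V g) = (c, d, \<eta>)" "(c, d, \<eta>) \<in> exp_arrows A C"
      using F'(4)[OF V'(4)[OF x(3)]] by (cases "FA F (FA V g)") auto
    have n: "is_ntrans A C \<eta>" "ntcod \<eta> = chain_top A C d"
      using g(2) by (auto simp: exp_arrows_iff)
    have U: "FA U f \<in> Arr A" "Dom A (FA U f) \<in> Obj A" "FO U (Dom A' f) = Dom A (FA U f)"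
      using fun_U(4,5)[OF x(2)] A.Dom_in[OF fun_U(4)[OF x(2)]] by simp_all
    have "FA (exp_action A' B' A C U V W F) g = (map whN c, map whN d, whN \<eta>)"
      using x g by simp
    then have "FA (bimorphism_of A' B' C' (exp_action A' B' A C U V W F)) x =
        Comp C' (FA W (FA (chain_top A C d) (FA U f))) (FA W (ntmap \<eta> (Dom A (FA U f))))"
      using x U by (simp add: X'.bimorphism_of_simps(2)[OF E] whisker_chain_top A'.Dom_in)
    also have "\<dots> = FA W (Comp C (FA (chain_top A C d) (FA U f)) (ntmap \<eta> (Dom A (FA U f))))"
      using is_functorD(4-6)[OF is_ntransD(2)[OF n(1)] U(1)] is_ntransD(4-6)[OF n(1) U(2)] n(2)
      by (simp add: fun_W)
    also have "\<dots> = FA (bi_action A' B' U V W (bimorphism_of A B C F)) x"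
      using x g U V'(4) by (simp add: X.bimorphism_of_simps(2)[OF F])
    finally show "FA (bimorphism_of A' B' C' (exp_action A' B' A C U V W F)) x =
        FA (bi_action A' B' U V W (bimorphism_of A B C F)) x" .
  qed simp_all
qed

lemma bi_action_bimorphism:
  assumes H: "bimorphism A B C H"
  shows "bimorphism A' B' C' (bi_action A' B' U V W H)"
proof -
  interpret B: precontextual B by (rule B)
  interpret B': precontextual B' by (rule B')
  interpret X: currying A B C ..
  interpret X': currying A' B' C' ..
  show ?thesis
    using X'.bimorphism_of_bimorphism[OF exp_action_ctx_functor[OF X.curry_exp_ctx_functor[OF H]]]
    by (simp add: bimorphism_of_exp_action[OF X.curry_exp_ctx_functor[OF H]] X.bimorphism_of_curry_exp[OF H])
qed

end

end

section \<open>Identities and composites of the two actions\<close>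

lemma whiskeringI:
  assumes "precontextual A" "contextual C" "precontextual A'" "contextual C'"
    and "ctx_functor A' A U" "ctx_functor C C' W"
  shows "whiskering C C' W A A' U"
  using assms by (simp add: whiskering_def whiskering_axioms_def contextual_functor_def contextual_functor_axioms_def)

lemma exp_action_id:
  assumes "precontextual B" "ctx_functor B (exponential A C) F"
  shows "exp_action A B A C (id_functor A) (id_functor B) (id_functor C) F = F"
proof -
  interpret B: precontextual B by fact
  note F = is_functorD[OF ctx_functorD(1)[OF assms(2)]]
  \<comment> \<open>The entries of a valid chain are extensional transformations, so whiskering with
    identities returns them exactly.\<close>
  have m: "map (whisker_ntrans A (id_functor A) (id_functor C)) c = c" if "is_chain A C c" for c
    using is_chain_ntrans[OF that] by (intro map_idI whisker_ntrans_id)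
  show ?thesis
  proof (rule func_eqI[of _ "Obj B" _ "Arr B"])
    fix b assume b: "b \<in> Obj B"
    then show "FO (exp_action A B A C (id_functor A) (id_functor B) (id_functor C) F) b = FO F b"
      using F(3)[OF b] m by (simp add: exp_map_def)
  next
    fix g assume g: "g \<in> Arr B"
    moreover obtain c d \<eta> where "FA F g = (c, d, \<eta>)" "(c, d, \<eta>) \<in> exp_arrows A C"
      using F(4)[OF g] by (cases "FA F g") auto
    ultimately show "FA (exp_action A B A C (id_functor A) (id_functor B) (id_functor C) F) g = FA F g"
      using m whisker_ntrans_id[of A C \<eta>] by (simp add: exp_map_def exp_arrows_iff)
  qed (simp_all add: F)
qed

lemma bi_action_id:
  assumes "category A" "category B" "is_functor (prod_cat A B) C H"
  shows "bi_action A B (id_functor A) (id_functor B) (id_functor C) H = H"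
  using is_functorD(1-4)[OF assms(3)]
  by (intro func_eqI[of _ "Obj A \<times> Obj B" _ "Arr A \<times> Arr B"]) auto

lemma exp_action_comp:
  assumes "whiskering C C' W A A' U"
    and "ctx_functor A'' A' U'" "ctx_functor B' B V" "ctx_functor B'' B' V'"
    and F: "ctx_functor B (exponential A C) F"
  shows "exp_action A'' B'' A C (comp_functor A'' U U') (comp_functor B'' V V') (comp_functor C W' W) F =
    exp_action A'' B'' A' C' U' V' W' (exp_action A' B' A C U V W F)"
proof -
  interpret whiskering C C' W A A' U by fact
  note F' = is_functorD[OF ctx_functorD(1)[OF F]]
  note V = is_functorD[OF ctx_functorD(1)[OF assms(3)]] and V' = is_functorD[OF ctx_functorD(1)[OF assms(4)]]
  note wc = whisker_ntrans_comp[OF ctx_functorD(1)[OF assms(2)] ctx_functorD(1)[OF ctx_U]]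
  have m: "map (whisker_ntrans A'' (comp_functor A'' U U') (comp_functor C W' W)) c =
      map (whisker_ntrans A'' U' W') (map whN c)" if "is_chain A C c" for c
    using is_chain_ntrans[OF that] by (simp add: wc)
  show ?thesis
  proof (rule func_eqI[of _ "Obj B''" _ "Arr B''"])
    fix b assume b: "b \<in> Obj B''"
    have "is_chain A C (FO F (FO V (FO V' b)))"
      using F'(3)[OF V(3)[OF V'(3)[OF b]]] by simp
    then show "FO (exp_action A'' B'' A C (comp_functor A'' U U') (comp_functor B'' V V') (comp_functor C W' W) F) b =
        FO (exp_action A'' B'' A' C' U' V' W' (exp_action A' B' A C U V W F)) b"
      using b V'(3)[OF b] m whisker_is_chain by (simp add: exp_map_def)
  next
    fix g assume g: "g \<in> Arr B''"
    obtain c d \<eta> where f: "FA F (FA V (FA V' g)) = (c, d, \<eta>)" "(c, d, \<eta>) \<in> exp_arrows A C"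
      using F'(4)[OF V(4)[OF V'(4)[OF g]]] by (cases "FA F (FA V (FA V' g))") auto
    then have "is_chain A C c" "is_chain A C d" "is_ntrans A C \<eta>"
      by (auto simp: exp_arrows_iff)
    then show "FA (exp_action A'' B'' A C (comp_functor A'' U U') (comp_functor B'' V V') (comp_functor C W' W) F) g =
        FA (exp_action A'' B'' A' C' U' V' W' (exp_action A' B' A C U V W F)) g"
      using g V'(4)[OF g] m f whisker_exp_arrows[OF f(2)] by (simp add: exp_map_def wc)
  qed simp_all
qed

lemma bi_action_comp:
  assumes "ctx_functor A' A U" "ctx_functor A'' A' U'" "ctx_functor B' B V" "ctx_functor B'' B' V'"
    and "is_functor (prod_cat A B) C H"
  shows "bi_action A'' B'' (comp_functor A'' U U') (comp_functor B'' V V') (comp_functor C W' W) H =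
    bi_action A'' B'' U' V' W' (bi_action A' B' U V W H)"
  using is_functorD(3,4)[OF ctx_functorD(1)[OF assms(1)]] is_functorD(3,4)[OF ctx_functorD(1)[OF assms(2)]]
    is_functorD(3,4)[OF ctx_functorD(1)[OF assms(3)]] is_functorD(3,4)[OF ctx_functorD(1)[OF assms(4)]]
    is_functorD(3,4)[OF assms(5)]
  by (intro func_eqI[of _ "Obj A'' \<times> Obj B''" _ "Arr A'' \<times> Arr B''"]) auto

theorem proposition3p26:
  fixes A :: "('oa, 'ma) precon" and A' :: "('oa1, 'ma1) precon" and A'' :: "('oa2, 'ma2) precon"
    and B :: "('ob, 'mb) precon" and B' :: "('ob1, 'mb1) precon" and B'' :: "('ob2, 'mb2) precon"
    and C :: "('oc, 'mc) precon" and C' :: "('oc1, 'mc1) precon" and C'' :: "('oc2, 'mc2) precon"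
  assumes "precontextual A" and "precontextual B" and "contextual C"
  shows
    "(\<forall>H. is_functor (prod_cat A B) C H \<longrightarrow>
        (bimorphism A B C H \<longleftrightarrow>
          (\<exists>F. ctx_functor B (exponential A C) F \<and>
               H = uncurry_functor A B C (comp_functor B (heart A C) F)))) \<and>
     bij_betw (bimorphism_of A B C) {F. ctx_functor B (exponential A C) F} {H. bimorphism A B C H} \<and>
     (\<comment> \<open>naturality\<close>
      precontextual A' \<and> precontextual B' \<and> contextual C' \<longrightarrow>
      (\<forall>U V W. ctx_functor A' A U \<and> ctx_functor B' B V \<and> ctx_functor C C' W \<longrightarrow>
         ctx_functor (exponential A C) (exponential A' C') (exp_map A' A C U W) \<and>
         (\<forall>F. ctx_functor B (exponential A C) F \<longrightarrow>
            ctx_functor B' (exponential A' C') (exp_action A' B' A C U V W F)) \<and>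
         (\<forall>H. bimorphism A B C H \<longrightarrow> bimorphism A' B' C' (bi_action A' B' U V W H)) \<and>
         (\<forall>F. ctx_functor B (exponential A C) F \<longrightarrow>
            bimorphism_of A' B' C' (exp_action A' B' A C U V W F) =
            bi_action A' B' U V W (bimorphism_of A B C F)))) \<and>
     (\<comment> \<open>both sides are functors of the three arguments: identities\<close>
      (\<forall>F. ctx_functor B (exponential A C) F \<longrightarrow>
         exp_action A B A C (id_functor A) (id_functor B) (id_functor C) F = F) \<and>
      (\<forall>H. bimorphism A B C H \<longrightarrow>
         bi_action A B (id_functor A) (id_functor B) (id_functor C) H = H)) \<and>
     (\<comment> \<open>both sides are functors of the three arguments: composites\<close>
      precontextual A' \<and> precontextual B' \<and> contextual C' \<and>
      precontextual A'' \<and> precontextual B'' \<and> contextual C'' \<longrightarrow>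
      (\<forall>U V W U' V' W'.
         ctx_functor A' A U \<and> ctx_functor B' B V \<and> ctx_functor C C' W \<and>
         ctx_functor A'' A' U' \<and> ctx_functor B'' B' V' \<and> ctx_functor C' C'' W' \<longrightarrow>
         (\<forall>F. ctx_functor B (exponential A C) F \<longrightarrow>
            exp_action A'' B'' A C
              (comp_functor A'' U U') (comp_functor B'' V V') (comp_functor C W' W) F =
            exp_action A'' B'' A' C' U' V' W' (exp_action A' B' A C U V W F)) \<and>
         (\<forall>H. bimorphism A B C H \<longrightarrow>
            bi_action A'' B''
              (comp_functor A'' U U') (comp_functor B'' V V') (comp_functor C W' W) H =
            bi_action A'' B'' U' V' W' (bi_action A' B' U V W H))))"
proof -
  interpret A: precontextual A by fact
  interpret B: precontextual B by fact
  interpret C: contextual C by fact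
  interpret X: currying A B C ..
  have isf: "is_functor (prod_cat A B) C H" if "bimorphism A B C H" for H
    using that by (simp add: bimorphism_def)
  \<comment> \<open>The characterisation is the image equality contained in the bijection.\<close>
  have bi: "bimorphism A B C H \<longleftrightarrow> (\<exists>F. ctx_functor B (exponential A C) F \<and>
      H = uncurry_functor A B C (comp_functor B (heart A C) F))" for H
    using X.bimorphism_of_bij unfolding bij_betw_def bimorphism_of_def by blast
  show ?thesis
    (is "?iff \<and> ?bij \<and> ?nat \<and> (?idF \<and> ?idH) \<and> ?comp")
  proof (intro conjI)
    show ?iff
      using bi by simp
    show ?bij
      by (rule X.bimorphism_of_bij)
    show ?nat
    proof (intro impI allI, elim conjE, goal_cases)
      case (1 U V W)
      then have w: "whiskering C C' W A A' U"
        using whiskeringI assms(1,3) by blast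
      note V = assms(2) \<open>precontextual B'\<close> \<open>ctx_functor B' B V\<close>
      show ?case
        by (intro conjI allI impI whiskering.exp_map_ctx_functor[OF w] whiskering.exp_action_ctx_functor[OF w V]
            whiskering.bi_action_bimorphism[OF w V] whiskering.bimorphism_of_exp_action[OF w V])
    qed
    show ?idF
      by (intro allI impI exp_action_id[OF assms(2)])
    show ?idH
      by (intro allI impI bi_action_id[OF A.category_axioms B.category_axioms isf])
    show ?comp
    proof (intro impI allI, elim conjE, goal_cases)
      case (1 U V W U' V' W')
      then have w: "whiskering C C' W A A' U"
        using whiskeringI assms(1,3) by blast
      note exp_action_comp[OF w \<open>ctx_functor A'' A' U'\<close> \<open>ctx_functor B' B V\<close> \<open>ctx_functor B'' B' V'\<close>]
        bi_action_comp[OF \<open>ctx_functor A' A U\<close> \<open>ctx_functor A'' A' U'\<close> \<open>ctx_functor B' B V\<close>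
          \<open>ctx_functor B'' B' V'\<close> isf]
      then show ?case
        by (intro conjI allI impI)
    qed
  qed
qed

end
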